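(* Let $K$ be a complete discretely valued field with ring of integers $\mathcal{O}_K$, uniformiser $\pi$ and residue field of characteristic not equal to $2$. Let $G$ be a compact group, let $\rho\colon G\to \mathrm{GL}_2(K)$ be a continuous representation, and let $n$ be a positive integer. The following are equivalent: (i) there exist two vertices $x,y\in \mathcal{X}(\rho)$ with $d(x,y)=n$; (ii) there exists a pair of characters (group homomorphisms) $\chi_1,\chi_2\colon G\to(\mathcal{O}_K/\pi^n\mathcal{O}_K)^\times$ such that $\operatorname{tr}\rho(g)\equiv\chi_1(g)+\chi_2(g)\pmod{\pi^n}$ for all $g\in G$.
   Context: A lattice is a free rank-$2$ $\mathcal{O}_K$-submodule of $K^2$ spanning $K^2$. The Bruhat--Tits tree $\mathcal{X}$ of $\mathrm{PGL}_2(K)$ has as vertices the homothety classes of lattices; for vertices $x,y$ the distance $d(x,y)$ is the unique integer $d\ge 0$ for which there exist representatives $\Lambda_x,\Lambda_y$ and a basis $(v_1,v_2)$ of $\Lambda_x$ such that $(v_1,\pi^d v_2)$ is a basis of $\Lambda_y$ (this is the graph distance, two vertices being adjacent when $\pi\Lambda_x\subsetneq\Lambda_y\subsetneq\Lambda_x$ for some representatives). $\mathcal{X}(\rho)$ denotes the set (induced subgraph) of vertices $x$ whose representatives $\Lambda_x$ satisfy $\rho(g)\Lambda_x\subseteq\Lambda_x$ for all $g\in G$. (Since $G$ is compact and $\rho$ continuous, $\rho(G)$ stabilises some lattice, so traces lie in $\mathcal{O}_K$.) *)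

theory Defs
  imports "HOL-Analysis.Analysis" "HOL-Algebra.QuotRing" "HOL-Algebra.Multiplicative_Group"
begin

section \<open>Complete discretely valued fields\<close>

text \<open>
  The valuation is normalised (value group \<open>\<int>\<close>) and integer valued; the convention
  \<open>v 0 = \<infinity>\<close> is replaced by guards, and the value of \<open>v\<close> at \<open>0\<close> is irrelevant throughout.
\<close>

locale discretely_valued_field =
  fixes v :: "'k::field \<Rightarrow> int"
  assumes val_mult: "x \<noteq> 0 \<Longrightarrow> y \<noteq> 0 \<Longrightarrow> v (x * y) = v x + v y"
    and val_add: "x \<noteq> 0 \<Longrightarrow> y \<noteq> 0 \<Longrightarrow> x + y \<noteq> 0 \<Longrightarrow> min (v x) (v y) \<le> v (x + y)"
    and val_surj: "v ` (UNIV - {0}) = UNIV"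

definition val_dist :: "('k::field \<Rightarrow> int) \<Rightarrow> 'k \<Rightarrow> 'k \<Rightarrow> real" where
  "val_dist v x y = (if x = y then 0 else 2 powi (- v (x - y)))"

definition val_topology :: "('k::field \<Rightarrow> int) \<Rightarrow> 'k topology" where
  "val_topology v = Metric_space.mtopology UNIV (val_dist v)"

locale complete_discretely_valued_field = discretely_valued_field +
  assumes complete: "Metric_space.mcomplete UNIV (val_dist v)"

definition uniformiser :: "('k::field \<Rightarrow> int) \<Rightarrow> 'k \<Rightarrow> bool" where
  "uniformiser v p \<longleftrightarrow> p \<noteq> 0 \<and> v p = 1"

definition val_ring :: "('k::field \<Rightarrow> int) \<Rightarrow> 'k ring" where
  "val_ring v = \<lparr>carrier = {x. x = 0 \<or> 0 \<le> v x}, monoid.mult = (*), one = 1, zero = 0, add = (+)\<rparr>"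

definition residue_ring_pow :: "('k::field \<Rightarrow> int) \<Rightarrow> 'k \<Rightarrow> nat \<Rightarrow> 'k set ring" where
  "residue_ring_pow v p n = val_ring v Quot (PIdl\<^bsub>val_ring v\<^esub> (p ^ n))"

definition residue_class :: "('k::field \<Rightarrow> int) \<Rightarrow> 'k \<Rightarrow> nat \<Rightarrow> 'k \<Rightarrow> 'k set" where
  "residue_class v p n x = PIdl\<^bsub>val_ring v\<^esub> (p ^ n) +>\<^bsub>val_ring v\<^esub> x"

text \<open>Additive order of \<open>1\<close>; \<^const>\<open>group.ord\<close> is \<open>0\<close> on elements of infinite order.\<close>

definition ring_characteristic :: "('a, 'b) ring_scheme \<Rightarrow> nat" where
  "ring_characteristic R = group.ord (add_monoid R) \<one>\<^bsub>R\<^esub>"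

context discretely_valued_field
begin

lemma val_one: "v 1 = 0"
  using val_mult[of 1 1] by simp

lemma val_uminus: "v (- x) = v x"
proof (cases "x = 0")
  case False
  have "v (-1) = 0"
    using val_mult[of "-1" "-1"] val_one by simp
  then show ?thesis
    using val_mult[of "-1" x] False by simp
qed simp

lemma val_minus_commute: "v (x - y) = v (y - x)"
  using val_uminus[of "x - y"] by simp

lemma Metric_space_val_dist: "Metric_space UNIV (val_dist v)"
proof
  fix x y z :: 'k
  show "0 \<le> val_dist v x y"
    by (simp add: val_dist_def)
  show "val_dist v x y = val_dist v y x"
    using val_minus_commute[of x y] by (simp add: val_dist_def)
  show "val_dist v x y = 0 \<longleftrightarrow> x = y"
    by (simp add: val_dist_def)
  show "val_dist v x z \<le> val_dist v x y + val_dist v y z"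
  proof (cases "x = y \<or> y = z \<or> x = z")
    case True
    then show ?thesis by (auto simp: val_dist_def)
  next
    case False
    then have "min (v (x - y)) (v (y - z)) \<le> v (x - z)"
      using val_add[of "x - y" "y - z"] by simp
    then have "(2::real) powi (- v (x - z)) \<le> 2 powi (- v (x - y)) \<or>
        (2::real) powi (- v (x - z)) \<le> 2 powi (- v (y - z))"
      by (auto simp: min_def split: if_splits intro!: power_int_increasing)
    moreover have "(0::real) < 2 powi (- v (x - y))" "(0::real) < 2 powi (- v (y - z))"
      by simp_all
    ultimately have "(2::real) powi (- v (x - z)) \<le> 2 powi (- v (x - y)) + 2 powi (- v (y - z))"
      by linarith
    then show ?thesis
      using False by (auto simp: val_dist_def)
  qed
qed

lemma cring_val_ring: "cring (val_ring v)"
proof (rule cringI)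
  have add_closed: "x + y = 0 \<or> 0 \<le> v (x + y)"
    if "x = 0 \<or> 0 \<le> v x" "y = 0 \<or> 0 \<le> v y" for x y
    using that val_add[of x y] by fastforce
  show "abelian_group (val_ring v)"
  proof (rule abelian_groupI)
    fix x assume "x \<in> carrier (val_ring v)"
    then show "\<exists>y\<in>carrier (val_ring v). y \<oplus>\<^bsub>val_ring v\<^esub> x = \<zero>\<^bsub>val_ring v\<^esub>"
      by (intro bexI[of _ "- x"]) (auto simp: val_ring_def val_uminus)
  qed (use add_closed in \<open>auto simp: val_ring_def algebra_simps\<close>)
  show "comm_monoid (val_ring v)"
  proof (rule comm_monoidI)
    fix x y assume "x \<in> carrier (val_ring v)" "y \<in> carrier (val_ring v)"
    then show "x \<otimes>\<^bsub>val_ring v\<^esub> y \<in> carrier (val_ring v)"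
      by (cases "x = 0 \<or> y = 0") (auto simp: val_ring_def val_mult)
  qed (auto simp: val_ring_def val_one)
qed (auto simp: val_ring_def algebra_simps)

end


section \<open>Continuous representations of compact groups\<close>

locale compact_group = group G for G :: "('g, 'b) monoid_scheme" (structure) +
  fixes T :: "'g topology"
  assumes topspace_eq: "topspace T = carrier G"
    and compact: "compact_space T"
    and continuous_mult: "continuous_map (prod_topology T T) T (\<lambda>(x, y). x \<otimes> y)"
    and continuous_inv: "continuous_map T T (m_inv G)"

definition GL2 :: "('k::field^2^2) monoid" where
  "GL2 = \<lparr>carrier = {A. invertible A}, monoid.mult = (**), one = mat 1\<rparr>"

text \<open>
  The topology on \<open>GL\<^sub>2(K)\<close> is induced from the product topology on the four matrix entries.
\<close>

definition GL2_topology :: "('k::field \<Rightarrow> int) \<Rightarrow> ('k^2^2) topology" where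
  "GL2_topology v =
     pullback_topology (carrier GL2) (\<lambda>A (i, j). A $ i $ j)
       (product_topology (\<lambda>_. val_topology v) (UNIV :: (2 \<times> 2) set))"

definition continuous_rep ::
    "('g, 'b) monoid_scheme \<Rightarrow> 'g topology \<Rightarrow> ('k::field \<Rightarrow> int) \<Rightarrow> ('g \<Rightarrow> 'k^2^2) \<Rightarrow> bool" where
  "continuous_rep G T v \<rho> \<longleftrightarrow> \<rho> \<in> hom G GL2 \<and> continuous_map T (GL2_topology v) \<rho>"


section \<open>Vertices of the Bruhat--Tits tree\<close>

text \<open>\<open>(b\<^sub>1, b\<^sub>2)\<close> is a basis of \<open>L\<close> as a free module over the valuation ring.\<close>

definition lattice_basis ::
    "('k::field \<Rightarrow> int) \<Rightarrow> 'k^2 \<Rightarrow> 'k^2 \<Rightarrow> ('k^2) set \<Rightarrow> bool" where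
  "lattice_basis v b1 b2 L \<longleftrightarrow>
     bij_betw (\<lambda>(s, t). s *s b1 + t *s b2) (carrier (val_ring v) \<times> carrier (val_ring v)) L"

definition lattices :: "('k::field \<Rightarrow> int) \<Rightarrow> ('k^2) set set" where
  "lattices v = {L. (\<exists>b1 b2. lattice_basis v b1 b2 L) \<and> vec.span L = UNIV}"

definition homothety :: "('k::field \<Rightarrow> int) \<Rightarrow> (('k^2) set \<times> ('k^2) set) set" where
  "homothety v = {(L, M). L \<in> lattices v \<and> M \<in> lattices v \<and> (\<exists>c. c \<noteq> 0 \<and> M = (\<lambda>u. c *s u) ` L)}"

definition vertices :: "('k::field \<Rightarrow> int) \<Rightarrow> ('k^2) set set set" where
  "vertices v = lattices v // homothety v"

definition vertex_dist ::
    "('k::field \<Rightarrow> int) \<Rightarrow> 'k \<Rightarrow> ('k^2) set set \<Rightarrow> ('k^2) set set \<Rightarrow> nat" where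
  "vertex_dist v p x y = (THE d. \<exists>L\<in>x. \<exists>M\<in>y. \<exists>b1 b2.
     lattice_basis v b1 b2 L \<and> lattice_basis v b1 (p ^ d *s b2) M)"

definition stable_vertices ::
    "('g, 'b) monoid_scheme \<Rightarrow> ('k::field \<Rightarrow> int) \<Rightarrow> ('g \<Rightarrow> 'k^2^2) \<Rightarrow> ('k^2) set set set" where
  "stable_vertices G v \<rho> =
     {x \<in> vertices v. \<forall>L\<in>x. \<forall>g\<in>carrier G. (\<lambda>u. \<rho> g *v u) ` L \<subseteq> L}"

end

(*
  Let X(g) be the traceless part of rho(g) on a stable lattice, which exists by compactness. If
  tr rho = chi1 + chi2 modulo p^n and delta = (chi1 - chi2)/2, then
  tr (X(g) X(h)) = 2 delta(g) delta(h) modulo p^n, so the trace form on the X(g) has rank at most one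
  modulo p^n. This alone forces the X(g) into the shape [[*, *], [p^n *, *]] in a suitable basis, and
  then the lattices spanned by (v1, v2) and (v1, p^n v2) are both stable. The argument is a descent
  from n to n - 2. If some delta(g) is a unit, X(g) can be diagonalised modulo p^n and the products
  of opposite off-diagonal entries vanish modulo p^n, so a diagonal rescaling suffices. Otherwise the
  form vanishes modulo p, the X(g) are simultaneously strictly triangular modulo p, and (for n >= 2)
  a further rescaling makes all of them divisible by p, so that X/p and delta/p satisfy the
  hypothesis modulo p^(n-2).
*)
theory Submission
  imports Defs
begin

section \<open>Fractional ideals\<close>

text \<open>The term 2 delta(g) delta(h) comes from tr (X(g) X(h)) = tr rho(gh) - tr rho(g) tr
  rho(h) / 2: substituting chi1 + chi2 for the trace and using multiplicativity leaves (chi1 -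
  chi2)(g) (chi1 - chi2)(h) / 2. The halves make sense because the residue characteristic is not 2.
  The obstacle is that chi1 and chi2 may agree modulo p; then no matrix has distinct eigenvalues
  modulo p that could be used to diagonalise it. Division by p is the way out, but X/p no longer
  comes from a representation, nor delta/p from characters. The group is therefore forgotten before
  the descent: the induction concerns integral traceless matrices over an arbitrary index set and an
  arbitrary integral function d, tied together only by the congruence for the trace form. The form
  is quadratic, so one division by p costs two powers of p in the congruence. A diagonal conjugation
  at the end of each round regains both.\<close>

context discretely_valued_field
begin

text \<open>Membership in a fractional ideal. A congruence modulo p^n is written as
  \<open>val_ge (int n)\<close> of a difference, which keeps the matrix argument inside K; residue
  rings are confined to the statements about characters and the residue characteristic.\<close>

definition val_ge :: "int \<Rightarrow> 'k \<Rightarrow> bool" where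
  "val_ge k x \<longleftrightarrow> x = 0 \<or> k \<le> v x"

lemma val_ge_zero [simp]: "val_ge k 0"
  by (simp add: val_ge_def)

lemma val_ge_one [simp]: "val_ge 0 1"
  by (simp add: val_ge_def val_one)

lemma val_ge_add: "val_ge k x \<Longrightarrow> val_ge k y \<Longrightarrow> val_ge k (x + y)"
  using val_add[of x y] by (fastforce simp: val_ge_def)

lemma val_ge_uminus [simp]: "val_ge k (- x) \<longleftrightarrow> val_ge k x"
  by (simp add: val_ge_def val_uminus)

lemma val_ge_diff: "val_ge k x \<Longrightarrow> val_ge k y \<Longrightarrow> val_ge k (x - y)"
  using val_ge_add[of k x "- y"] by simp

lemma val_ge_cong: "val_ge k (x - y) \<Longrightarrow> val_ge k x \<longleftrightarrow> val_ge k y"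
  using val_ge_add[of k "x - y" y] val_ge_diff[of k x "x - y"] by auto

lemma val_ge_mono: "val_ge k x \<Longrightarrow> j \<le> k \<Longrightarrow> val_ge j x"
  by (auto simp: val_ge_def)

lemma val_ge_mult: "val_ge j x \<Longrightarrow> val_ge k y \<Longrightarrow> val_ge (j + k) (x * y)"
  by (cases "x = 0 \<or> y = 0") (auto simp: val_ge_def val_mult)

lemma val_ge_mult_left: "val_ge 0 x \<Longrightarrow> val_ge k y \<Longrightarrow> val_ge k (x * y)"
  using val_ge_mult[of 0 x k y] by simp

lemma val_ge_mult_right: "val_ge k x \<Longrightarrow> val_ge 0 y \<Longrightarrow> val_ge k (x * y)"
  using val_ge_mult[of k x 0 y] by simp

lemma val_ge_mult_iff: "x \<noteq> 0 \<Longrightarrow> val_ge k (x * y) \<longleftrightarrow> val_ge (k - v x) y"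
  by (cases "y = 0") (auto simp: val_ge_def val_mult)

lemma val_inverse: "x \<noteq> 0 \<Longrightarrow> v (inverse x) = - v x"
  using val_mult[of x "inverse x"] by (simp add: val_one)

lemma val_ge_divide_iff: "y \<noteq> 0 \<Longrightarrow> val_ge k (x / y) \<longleftrightarrow> val_ge (k + v y) x"
  using val_ge_mult_iff[of "inverse y" k x] by (simp add: val_inverse divide_inverse mult.commute)

lemma val_uniformiser_power:
  assumes "uniformiser v p"
  shows "p ^ n \<noteq> 0" "v (p ^ n) = int n"
  using assms by (induction n) (simp_all add: uniformiser_def val_one val_mult)

lemma val_ge_unit: "val_ge 0 x \<Longrightarrow> \<not> val_ge 1 x \<Longrightarrow> x \<noteq> 0 \<and> v x = 0"
  by (auto simp: val_ge_def)

lemma val_ge_unit_mult_iff: "val_ge 0 x \<Longrightarrow> \<not> val_ge 1 x \<Longrightarrow> val_ge k (x * y) \<longleftrightarrow> val_ge k y"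
  using val_ge_unit[of x] val_ge_mult_iff[of x] by simp

lemma val_ge_unit_divide_iff: "val_ge 0 y \<Longrightarrow> \<not> val_ge 1 y \<Longrightarrow> val_ge k (x / y) \<longleftrightarrow> val_ge k x"
  using val_ge_unit[of y] val_ge_divide_iff[of y] by simp

text \<open>Valuations are integers, so 2 v(x) >= 2k - 1 already gives v(x) >= k. For k = 1: if p
  divides a square, it divides its root.\<close>

lemma val_ge_square:
  assumes "val_ge (2 * k - 1) (x * x)"
  shows "val_ge k x"
  using assms by (cases "x = 0") (auto simp: val_ge_def val_mult)

text \<open>If neither factor had valuation at least \<open>k\<close>, then \<open>x\<close> and \<open>y\<close> would both have
  valuation less than \<open>k\<close>.\<close>

lemma val_ge_of_sum_of_product:
  assumes "val_ge k (x + y)" "val_ge (2 * k) (x * y)"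
  shows "val_ge k x" "val_ge k y"
proof -
  have "val_ge k x \<longleftrightarrow> val_ge k y"
    using val_ge_cong[of k x "- y"] assms(1) by simp
  moreover have "val_ge k x \<or> val_ge k y"
    using assms(2) by (cases "x = 0 \<or> y = 0") (auto simp: val_ge_def val_mult)
  ultimately show "val_ge k x" "val_ge k y"
    by auto
qed

text \<open>Polarisation: \<open>(\<beta> \<gamma>')(\<beta>' \<gamma>) = (\<beta> \<gamma>)(\<beta>' \<gamma>')\<close>.\<close>

lemma val_ge_cross_products:
  assumes "v 2 = 0" "(2::'k) \<noteq> 0"
    and form: "\<And>i j. i \<in> I \<Longrightarrow> j \<in> I \<Longrightarrow> val_ge k (b i * c j + b j * c i)"
    and "i \<in> I" "j \<in> I"
  shows "val_ge k (b i * c j)"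
proof -
  have diag: "val_ge k (b l * c l)" if "l \<in> I" for l
    using form[OF that that] val_ge_mult_iff[of 2 k "b l * c l"] assms(1,2) by simp
  have "val_ge (2 * k) ((b i * c j) * (b j * c i))"
    using val_ge_mult[OF diag diag] assms(4,5) by (simp add: mult_ac)
  with form[OF assms(4,5)] show ?thesis
    by (rule val_ge_of_sum_of_product(1))
qed

end


section \<open>Simultaneous conjugation of traceless matrices\<close>

definition mat2 :: "'a \<Rightarrow> 'a \<Rightarrow> 'a \<Rightarrow> 'a \<Rightarrow> 'a::zero^2^2" where
  "mat2 a b c d = vector [vector [a, b], vector [c, d]]"

lemma mat2_nth [simp]:
  "mat2 a b c d $ 1 $ 1 = a" "mat2 a b c d $ 1 $ 2 = b"
  "mat2 a b c d $ 2 $ 1 = c" "mat2 a b c d $ 2 $ 2 = d"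
  by (simp_all add: mat2_def vector_2)

lemma mat2_eq_iff:
  "(A :: 'a::zero^2^2) = B \<longleftrightarrow>
    A $ 1 $ 1 = B $ 1 $ 1 \<and> A $ 1 $ 2 = B $ 1 $ 2 \<and> A $ 2 $ 1 = B $ 2 $ 1 \<and> A $ 2 $ 2 = B $ 2 $ 2"
  by (auto simp: vec_eq_iff forall_2)

lemma matrix_mult_2_nth [simp]:
  "((A :: 'a::comm_ring_1^2^2) ** B) $ i $ j = A $ i $ 1 * B $ 1 $ j + A $ i $ 2 * B $ 2 $ j"
  by (simp add: matrix_matrix_mult_def sum_2)

lemma matrix_vector_mult_2_nth:
  "((A :: 'a::comm_ring_1^2^2) *v u) $ i = A $ i $ 1 * u $ 1 + A $ i $ 2 * u $ 2"
  by (simp add: matrix_vector_mult_def sum_2)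

lemma trace_2: "trace (A :: 'a::comm_ring_1^2^2) = A $ 1 $ 1 + A $ 2 $ 2"
  by (simp add: trace_def sum_2)

lemma invertible_2_iff:
  "invertible (A :: 'a::field^2^2) \<longleftrightarrow> A $ 1 $ 1 * A $ 2 $ 2 - A $ 1 $ 2 * A $ 2 $ 1 \<noteq> 0"
  by (simp add: invertible_det_nz det_2)

abbreviation sl2 :: "'a \<Rightarrow> 'a \<Rightarrow> 'a \<Rightarrow> 'a::ring_1^2^2" where
  "sl2 a b c \<equiv> mat2 a b c (- a)"

text \<open>P ranges over GL_2(K), not GL_2(O_K), since moving to another lattice is the purpose;
  the columns of P become the new basis. The form X P = P Y avoids inverses.\<close>

definition conj_families :: "'i set \<Rightarrow> ('i \<Rightarrow> 'a::field^2^2) \<Rightarrow> ('i \<Rightarrow> 'a^2^2) \<Rightarrow> bool" where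
  "conj_families I X Y \<longleftrightarrow> (\<exists>P. invertible P \<and> (\<forall>i\<in>I. X i ** P = P ** Y i))"

lemma conj_families_refl: "conj_families I X X"
  unfolding conj_families_def by (intro exI[of _ "mat 1"]) (auto simp: invertible_det_nz)

lemma conj_families_trans:
  assumes "conj_families I X Y" "conj_families I Y Z"
  shows "conj_families I X Z"
proof -
  obtain P Q where P: "invertible P" "\<And>i. i \<in> I \<Longrightarrow> X i ** P = P ** Y i"
    and Q: "invertible Q" "\<And>i. i \<in> I \<Longrightarrow> Y i ** Q = Q ** Z i"
    using assms by (auto simp: conj_families_def)
  have "X i ** (P ** Q) = (P ** Q) ** Z i" if "i \<in> I" for i
    using P(2)[OF that] Q(2)[OF that] by (metis matrix_mul_assoc)
  then show ?thesis
    using invertible_mult[OF P(1) Q(1)] by (auto simp: conj_families_def)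
qed

lemma conj_families_lower:
  "conj_families I (\<lambda>i. sl2 (a i) (b i) (c i))
    (\<lambda>i. sl2 (a i + b i * s) (b i) (c i - 2 * a i * s - b i * s * s))"
  unfolding conj_families_def
  by (intro exI[of _ "mat2 1 0 s 1"]) (auto simp: mat2_eq_iff invertible_2_iff algebra_simps)

lemma conj_families_upper:
  "conj_families I (\<lambda>i. sl2 (a i) (b i) (c i))
    (\<lambda>i. sl2 (a i - t * c i) (b i + 2 * a i * t - t * t * c i) (c i))"
  unfolding conj_families_def
  by (intro exI[of _ "mat2 1 t 0 1"]) (auto simp: mat2_eq_iff invertible_2_iff algebra_simps)

lemma conj_families_swap:
  "conj_families I (\<lambda>i. sl2 (a i) (b i) (c i)) (\<lambda>i. sl2 (- a i) (c i) (b i))"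
  unfolding conj_families_def
  by (intro exI[of _ "mat2 0 1 1 0"]) (auto simp: mat2_eq_iff invertible_2_iff)

lemma conj_families_diag:
  assumes "q \<noteq> 0"
  shows "conj_families I (\<lambda>i. sl2 (a i) (b i) (c i)) (\<lambda>i. sl2 (a i) (b i * q) (c i / q))"
  unfolding conj_families_def using assms
  by (intro exI[of _ "mat2 1 0 0 q"]) (auto simp: mat2_eq_iff invertible_2_iff)

text \<open>Conjugation is linear, so a base change found for the family divided by p also serves
  the original family.\<close>

lemma conj_families_scale:
  assumes "conj_families I (\<lambda>i. sl2 (a i) (b i) (c i)) (\<lambda>i. sl2 (a' i) (b' i) (c' i))"
  shows "conj_families I (\<lambda>i. sl2 (q * a i) (q * b i) (q * c i))
    (\<lambda>i. sl2 (q * a' i) (q * b' i) (q * c' i))"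
proof -
  obtain P where P: "invertible P"
    "\<And>i. i \<in> I \<Longrightarrow> sl2 (a i) (b i) (c i) ** P = P ** sl2 (a' i) (b' i) (c' i)"
    using assms by (auto simp: conj_families_def)
  have "sl2 (q * a i) (q * b i) (q * c i) ** P = P ** sl2 (q * a' i) (q * b' i) (q * c' i)"
    if "i \<in> I" for i
  proof -
    have "q * (sl2 (a i) (b i) (c i) ** P) $ k $ l = q * (P ** sl2 (a' i) (b' i) (c' i)) $ k $ l" for k l
      using P(2)[OF that] by simp
    from this[of 1 1] this[of 1 2] this[of 2 1] this[of 2 2] show ?thesis
      by (simp add: mat2_eq_iff algebra_simps)
  qed
  with P(1) show ?thesis
    by (auto simp: conj_families_def)
qed


section \<open>Families whose trace form has rank at most one modulo a power of p\<close>

locale uniformised_field = discretely_valued_field +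
  fixes p :: 'a
  assumes p_nz: "p \<noteq> 0" and val_p: "v p = 1"
    and two_nz: "(2::'a) \<noteq> 0" and val_two: "v 2 = 0"
begin

lemma uniformiser: "uniformiser v p"
  by (simp add: uniformiser_def p_nz val_p)

lemma val_p_power: "v (p ^ k) = int k"
  by (rule val_uniformiser_power(2)[OF uniformiser])

lemma val_ge_two_mult_iff: "val_ge k (2 * x) \<longleftrightarrow> val_ge k x"
  using val_ge_mult_iff[of 2] two_nz val_two by simp

lemma val_ge_two [simp]: "val_ge 0 2"
  by (simp add: val_ge_def val_two)

lemma val_ge_half_iff: "val_ge k (x / 2) \<longleftrightarrow> val_ge k x"
  using val_ge_divide_iff[of 2] two_nz val_two by simp

text \<open>The trace of the product of the traceless matrices with indices \<open>i\<close> and \<open>j\<close>.\<close>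

definition tr_form :: "('i \<Rightarrow> 'a) \<Rightarrow> ('i \<Rightarrow> 'a) \<Rightarrow> ('i \<Rightarrow> 'a) \<Rightarrow> 'i \<Rightarrow> 'i \<Rightarrow> 'a" where
  "tr_form a b c i j = 2 * a i * a j + b i * c j + b j * c i"

definition reducible_mod :: "'i set \<Rightarrow> nat \<Rightarrow> ('i \<Rightarrow> 'a) \<Rightarrow> ('i \<Rightarrow> 'a) \<Rightarrow> ('i \<Rightarrow> 'a) \<Rightarrow> bool" where
  "reducible_mod I m a b c \<longleftrightarrow> (\<exists>a' b' c'.
     conj_families I (\<lambda>i. sl2 (a i) (b i) (c i)) (\<lambda>i. sl2 (a' i) (b' i) (c' i)) \<and>
     (\<forall>i\<in>I. val_ge 0 (a' i) \<and> val_ge 0 (b' i) \<and> val_ge (int m) (c' i)))"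

lemma reducible_modI:
  assumes "conj_families I (\<lambda>i. sl2 (a i) (b i) (c i)) (\<lambda>i. sl2 (a' i) (b' i) (c' i))"
    and "\<And>i. i \<in> I \<Longrightarrow> val_ge 0 (a' i)" "\<And>i. i \<in> I \<Longrightarrow> val_ge 0 (b' i)"
    and "\<And>i. i \<in> I \<Longrightarrow> val_ge (int m) (c' i)"
  shows "reducible_mod I m a b c"
  using assms unfolding reducible_mod_def by blast

lemma reducible_mod_conj:
  assumes "conj_families I (\<lambda>i. sl2 (a i) (b i) (c i)) (\<lambda>i. sl2 (a' i) (b' i) (c' i))"
    and "reducible_mod I m a' b' c'"
  shows "reducible_mod I m a b c"
  using assms conj_families_trans unfolding reducible_mod_def by blast

text \<open>Because mixed products are divisible as well, the least valuations of the two families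
  add up to at least m. The witness k is the least valuation among the b i, capped at m.\<close>

lemma valuation_balance:
  assumes b: "\<And>i. i \<in> I \<Longrightarrow> val_ge 0 (b i)" and c: "\<And>i. i \<in> I \<Longrightarrow> val_ge 0 (c i)"
    and bc: "\<And>i j. i \<in> I \<Longrightarrow> j \<in> I \<Longrightarrow> val_ge (int m) (b i * c j)"
  obtains k where "k \<le> m" "\<And>i. i \<in> I \<Longrightarrow> val_ge (int k) (b i)"
    "\<And>i. i \<in> I \<Longrightarrow> val_ge (int (m - k)) (c i)"
proof (cases "\<forall>i\<in>I. val_ge (int m) (b i)")
  case True
  then show ?thesis
    using that[of m] c by auto
next
  case False
  let ?P = "\<lambda>k. \<not> (\<forall>i\<in>I. val_ge (int k) (b i))"
  have "\<not> ?P 0"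
    using b by simp
  \<comment> \<open>k is the last level before the first failure, so some b i has valuation exactly
    k. Searching below m avoids a minimum over a possibly infinite family.\<close>
  with False obtain k where k: "k < m" "\<And>l. l \<le> k \<Longrightarrow> \<not> ?P l" "?P (Suc k)"
    using ex_least_nat_less[of ?P m] by blast
  have bk: "val_ge (int k) (b i)" if "i \<in> I" for i
    using k(2)[of k] that by blast
  from k(3) obtain i where i: "i \<in> I" "\<not> val_ge (int (Suc k)) (b i)"
    by blast
  with bk[OF i(1)] have "b i \<noteq> 0" "v (b i) = int k"
    by (auto simp: val_ge_def)
  then have "val_ge (int (m - k)) (c j)" if "j \<in> I" for j
    using bc[OF i(1) that] val_ge_mult_iff[of "b i" "int m" "c j"] k(1) by (simp add: of_nat_diff)
  with bk k(1) show ?thesis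
    using that[of k] by auto
qed

text \<open>A diagonal conjugation moves the common factor p^k of the upper right entries to the
  lower left ones, which already carry p^(m - k).\<close>

lemma reducible_mod_of_products:
  assumes a: "\<And>i. i \<in> I \<Longrightarrow> val_ge 0 (a i)" and b: "\<And>i. i \<in> I \<Longrightarrow> val_ge 0 (b i)"
    and c: "\<And>i. i \<in> I \<Longrightarrow> val_ge 0 (c i)"
    and bc: "\<And>i j. i \<in> I \<Longrightarrow> j \<in> I \<Longrightarrow> val_ge (int m) (b i * c j)"
  shows "reducible_mod I m a b c"
proof -
  obtain k where k: "k \<le> m" "\<And>i. i \<in> I \<Longrightarrow> val_ge (int k) (b i)"
    "\<And>i. i \<in> I \<Longrightarrow> val_ge (int (m - k)) (c i)"
    using valuation_balance[where b = b and c = c and I = I and m = m] assms by metis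
  define q where "q = p ^ k"
  have q: "q \<noteq> 0" "v q = int k"
    by (simp_all add: q_def p_nz val_p_power)
  have conj: "conj_families I (\<lambda>i. sl2 (a i) (b i) (c i)) (\<lambda>i. sl2 (a i) (b i / q) (q * c i))"
    using conj_families_diag[of "inverse q" I a b c] q(1) by (simp add: field_simps)
  show ?thesis
  proof (rule reducible_modI[OF conj])
    show "val_ge 0 (b i / q)" if "i \<in> I" for i
      using k(2)[OF that] by (simp add: val_ge_divide_iff q)
    show "val_ge (int m) (q * c i)" if "i \<in> I" for i
      using k(3)[OF that] k(1) by (simp add: val_ge_mult_iff q of_nat_diff)
  qed (rule a)
qed

text \<open>The form is the trace of a product, hence invariant under simultaneous conjugation. This
  and the next three lemmas check it for the elementary base changes, so the congruence for the form
  survives each of them.\<close>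

lemma tr_form_lower:
  "tr_form (\<lambda>i. a i + b i * s) b (\<lambda>i. c i - 2 * a i * s - b i * s * s) i j = tr_form a b c i j"
  by (simp add: tr_form_def algebra_simps)

lemma tr_form_upper:
  "tr_form (\<lambda>i. a i - t * c i) (\<lambda>i. b i + 2 * a i * t - t * t * c i) c i j = tr_form a b c i j"
  by (simp add: tr_form_def algebra_simps)

lemma tr_form_swap: "tr_form (\<lambda>i. - a i) c b i j = tr_form a b c i j"
  by (simp add: tr_form_def algebra_simps)

lemma tr_form_diag: "q \<noteq> 0 \<Longrightarrow> tr_form a (\<lambda>i. b i * q) (\<lambda>i. c i / q) i j = tr_form a b c i j"
  by (simp add: tr_form_def)

definition integral_families :: "'i set \<Rightarrow> ('i \<Rightarrow> 'a) \<Rightarrow> ('i \<Rightarrow> 'a) \<Rightarrow> ('i \<Rightarrow> 'a) \<Rightarrow> bool" where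
  "integral_families I a b c \<longleftrightarrow> (\<forall>i\<in>I. val_ge 0 (a i) \<and> val_ge 0 (b i) \<and> val_ge 0 (c i))"

lemma integral_familiesD:
  assumes "integral_families I a b c" "i \<in> I"
  shows "val_ge 0 (a i)" "val_ge 0 (b i)" "val_ge 0 (c i)"
  using assms by (auto simp: integral_families_def)

lemma integral_lower:
  assumes "integral_families I a b c" "val_ge 0 s"
  shows "integral_families I (\<lambda>i. a i + b i * s) b (\<lambda>i. c i - 2 * a i * s - b i * s * s)"
  using assms by (auto simp: integral_families_def val_ge_two_mult_iff mult.assoc
      intro!: val_ge_add val_ge_diff val_ge_mult_left)

lemma integral_upper:
  assumes "integral_families I a b c" "val_ge 0 t"
  shows "integral_families I (\<lambda>i. a i - t * c i) (\<lambda>i. b i + 2 * a i * t - t * t * c i) c"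
  using assms by (auto simp: integral_families_def val_ge_two_mult_iff mult.assoc
      intro!: val_ge_add val_ge_diff val_ge_mult_left)

text \<open>Modulo the maximal ideal, a space of matrices on which the trace form vanishes is spanned
  by a nilpotent one.\<close>

lemma triangular_mod_p:
  assumes int: "integral_families I a b c"
    and form: "\<And>i j. i \<in> I \<Longrightarrow> j \<in> I \<Longrightarrow> val_ge 1 (tr_form a b c i j)"
  obtains a' b' c' where
    "conj_families I (\<lambda>i. sl2 (a i) (b i) (c i)) (\<lambda>i. sl2 (a' i) (b' i) (c' i))"
    "integral_families I a' b' c'" "\<And>i. i \<in> I \<Longrightarrow> val_ge 1 (c' i)"
    "\<And>i j. tr_form a' b' c' i j = tr_form a b c i j"
proof (cases "\<forall>i\<in>I. val_ge 1 (c i)")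
  case True
  then show ?thesis
    using that[OF conj_families_refl int] by auto
next
  case False
  then obtain i where i: "i \<in> I" "\<not> val_ge 1 (c i)"
    by blast
  note ci = integral_familiesD(3)[OF int i(1)] i(2)
  have ci0: "c i \<noteq> 0"
    using i(2) by auto
  \<comment> \<open>Chosen to clear the diagonal of the matrix with index i, using that c i is a
    unit.\<close>
  define t where "t = a i / c i"
  have t: "val_ge 0 t"
    using val_ge_unit_divide_iff[OF ci] integral_familiesD(1)[OF int i(1)] by (simp add: t_def)
  define a' where "a' = (\<lambda>i. a i - t * c i)"
  define b' where "b' = (\<lambda>i. b i + 2 * a i * t - t * t * c i)"
  have conj: "conj_families I (\<lambda>i. sl2 (a i) (b i) (c i)) (\<lambda>i. sl2 (a' i) (b' i) (c i))"
    unfolding a'_def b'_def by (rule conj_families_upper)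
  have int': "integral_families I a' b' c"
    unfolding a'_def b'_def by (rule integral_upper[OF int t])
  have form': "tr_form a' b' c j k = tr_form a b c j k" for j k
    unfolding a'_def b'_def by (rule tr_form_upper)
  have a'i: "a' i = 0"
    using ci0 by (simp add: a'_def t_def)
  \<comment> \<open>With zero diagonal at i, the form at (i, i) is 2 c i b' i. Once b' i is
    divisible by p, the form at (i, j) determines b' j modulo p.\<close>
  have "val_ge 1 (2 * (c i * b' i))"
    using form[OF i(1) i(1)] a'i unfolding form'[symmetric] by (simp add: tr_form_def mult.commute)
  then have b'i: "val_ge 1 (b' i)"
    by (simp only: val_ge_two_mult_iff val_ge_unit_mult_iff[OF ci])
  have b': "val_ge 1 (b' j)" if j: "j \<in> I" for j
  proof -
    have "val_ge 1 (b' i * c j + b' j * c i)"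
      using form[OF i(1) j] a'i unfolding form'[symmetric] by (simp add: tr_form_def)
    moreover have "val_ge 1 (b' i * c j)"
      using val_ge_mult_right[OF b'i integral_familiesD(3)[OF int j]] .
    ultimately have "val_ge 1 (b' j * c i)"
      using val_ge_diff by fastforce
    then show ?thesis
      using val_ge_unit_mult_iff[OF ci, of 1 "b' j"] by (simp add: mult.commute)
  qed
  \<comment> \<open>The entries divisible by p are now the upper right ones; swapping the basis
    vectors brings them to the lower left.\<close>
  show ?thesis
  proof (rule that)
    show "conj_families I (\<lambda>i. sl2 (a i) (b i) (c i)) (\<lambda>i. sl2 ((\<lambda>i. - a' i) i) (c i) (b' i))"
      using conj_families_trans[OF conj conj_families_swap] by simp
    show "integral_families I (\<lambda>i. - a' i) c b'"
      using int' by (auto simp: integral_families_def)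
    show "tr_form (\<lambda>i. - a' i) c b' j k = tr_form a b c j k" for j k
      by (simp add: tr_form_swap form')
  qed (use b' in auto)
qed

text \<open>The matrix with index \<open>i\<close> has unit eigenvalues modulo \<open>p ^ m\<close>; conjugating it to
  \<open>sl2 u 0 0\<close> modulo \<open>p ^ m\<close> determines the diagonal entries of all the others.\<close>

lemma reducible_mod_of_unit_sum:
  assumes int: "integral_families I a b c"
    and d_int: "\<And>i. i \<in> I \<Longrightarrow> val_ge 0 (d i)"
    and form: "\<And>i j. i \<in> I \<Longrightarrow> j \<in> I \<Longrightarrow> val_ge (int m) (tr_form a b c i j - 2 * d i * d j)"
    and i: "i \<in> I" and unit: "\<not> val_ge 1 (d i)" and unit': "\<not> val_ge 1 (a i + d i)"
  shows "reducible_mod I m a b c"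
proof -
  define u where "u = d i"
  define w where "w = a i + u"
  \<comment> \<open>(a i + u, c i) is an eigenvector for u modulo p^m of the matrix with index i.
    Dividing by the unit a i + u gives (1, s), the first column of the lower unipotent base
    change.\<close>
  define s where "s = c i / w"
  have u_int: "val_ge 0 u" and u_unit: "\<not> val_ge 1 u"
    using d_int[OF i] unit by (simp_all add: u_def)
  have w_int: "val_ge 0 w" and w_unit: "\<not> val_ge 1 w"
    using val_ge_add[OF integral_familiesD(1)[OF int i] u_int] unit' by (simp_all add: u_def w_def)
  have u0: "u \<noteq> 0" and w0: "w \<noteq> 0"
    using u_unit w_unit by auto
  have s_int: "val_ge 0 s"
    using val_ge_unit_divide_iff[OF w_int w_unit] integral_familiesD(3)[OF int i] by (simp add: s_def)
  have q: "val_ge (int m) (a i * a i + b i * c i - u * u)"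
    using form[OF i i] val_ge_two_mult_iff[of "int m" "a i * a i + b i * c i - u * u"]
    by (simp add: tr_form_def u_def algebra_simps)

  define a1 where "a1 = (\<lambda>i. a i + b i * s)"
  define c1 where "c1 = (\<lambda>i. c i - 2 * a i * s - b i * s * s)"
  have conj1: "conj_families I (\<lambda>i. sl2 (a i) (b i) (c i)) (\<lambda>i. sl2 (a1 i) (b i) (c1 i))"
    unfolding a1_def c1_def by (rule conj_families_lower)
  have int1: "integral_families I a1 b c1"
    unfolding a1_def c1_def by (rule integral_lower[OF int s_int])
  have form1: "tr_form a1 b c1 j k = tr_form a b c j k" for j k
    unfolding a1_def c1_def by (rule tr_form_lower)
  \<comment> \<open>Both a1 i - u and c1 i are multiples of the determinant defect a^2 + b c - u^2,
    which the form at (i, i) makes divisible by p^m.\<close>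
  have "a1 i - u = (a i * a i + b i * c i - u * u) / w"
    using w0 by (simp add: a1_def s_def field_simps) (simp add: w_def algebra_simps)
  then have a1i: "val_ge (int m) (a1 i - u)"
    using q val_ge_unit_divide_iff[OF w_int w_unit] by simp
  have "c1 i = - (a i * a i + b i * c i - u * u) * (c i / w / w)"
    using w0 by (simp add: c1_def s_def field_simps) (simp add: w_def algebra_simps)
  moreover have "val_ge 0 (c i / w / w)"
    using val_ge_unit_divide_iff[OF w_int w_unit] integral_familiesD(3)[OF int i]
    by (simp del: divide_divide_eq_left)
  ultimately have c1i: "val_ge (int m) (c1 i)"
    using val_ge_mult_right q by (metis val_ge_uminus)

  \<comment> \<open>(t, 1) is the eigenvector for -u of the matrix with rows (u, b i) and (0, -u),
    to which the matrix with index i is now congruent.\<close>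
  define t where "t = - b i / (2 * u)"
  have t_int: "val_ge 0 t"
    using val_ge_unit_divide_iff[OF u_int u_unit] integral_familiesD(2)[OF int i]
      val_ge_half_iff[of 0 "b i / u"] by (simp add: t_def mult.commute)
  define a2 where "a2 = (\<lambda>i. a1 i - t * c1 i)"
  define b2 where "b2 = (\<lambda>i. b i + 2 * a1 i * t - t * t * c1 i)"
  have conj2: "conj_families I (\<lambda>i. sl2 (a1 i) (b i) (c1 i)) (\<lambda>i. sl2 (a2 i) (b2 i) (c1 i))"
    unfolding a2_def b2_def by (rule conj_families_upper)
  have int2: "integral_families I a2 b2 c1"
    unfolding a2_def b2_def by (rule integral_upper[OF int1 t_int])
  have form2: "tr_form a2 b2 c1 j k = tr_form a b c j k" for j k
    unfolding a2_def b2_def by (simp only: tr_form_upper form1)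
  have tc: "val_ge (int m) (t * c1 i)"
    using val_ge_mult_left[OF t_int c1i] .
  have a2i: "val_ge (int m) (a2 i - u)"
    using val_ge_diff[OF a1i tc] by (simp add: a2_def algebra_simps)
  have "b2 i = 2 * (t * (a1 i - u)) - t * (t * c1 i)"
    using u0 two_nz by (simp add: b2_def t_def field_simps)
  then have b2i: "val_ge (int m) (b2 i)"
    using val_ge_mult_left[OF t_int a1i] val_ge_mult_left[OF t_int tc]
    by (simp add: val_ge_diff val_ge_two_mult_iff)

  \<comment> \<open>Against a matrix congruent to \<open>sl2 u 0 0\<close> the form leaves 2 u a2 j,
    which must be congruent to 2 u d j; cancel the unit 2 u.\<close>
  have a2: "val_ge (int m) (a2 j - d j)" if j: "j \<in> I" for j
  proof -
    note intj = integral_familiesD[OF int2 j]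
    have "val_ge (int m) (tr_form a b c i j - 2 * d i * d j)"
      by (rule form[OF i j])
    moreover have "val_ge (int m) (b2 i * c1 j)" "val_ge (int m) (b2 j * c1 i)"
      "val_ge (int m) (2 * ((a2 i - u) * a2 j))"
      using val_ge_mult_right[OF b2i intj(3)] val_ge_mult_left[OF intj(2) c1i]
        val_ge_mult_right[OF a2i intj(1)] by (simp_all only: val_ge_two_mult_iff)
    ultimately have "val_ge (int m) (tr_form a b c i j - 2 * d i * d j
        - b2 i * c1 j - b2 j * c1 i - 2 * ((a2 i - u) * a2 j))"
      by (simp only: val_ge_diff)
    also have "tr_form a b c i j - 2 * d i * d j - b2 i * c1 j - b2 j * c1 i
        - 2 * ((a2 i - u) * a2 j) = 2 * (u * (a2 j - d j))"
      unfolding form2[symmetric] by (simp add: tr_form_def u_def algebra_simps)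
    finally show ?thesis
      by (simp only: val_ge_two_mult_iff val_ge_unit_mult_iff[OF u_int u_unit])
  qed
  \<comment> \<open>Since the diagonal entries agree with d, they account for 2 d j d k and only the
    off-diagonal part of the form remains.\<close>
  have "val_ge (int m) (b2 j * c1 k + b2 k * c1 j)" if jk: "j \<in> I" "k \<in> I" for j k
  proof -
    have "val_ge (int m) (a2 j * a2 k - d j * d k)"
    proof -
      have "a2 j * a2 k - d j * d k = (a2 j - d j) * a2 k + d j * (a2 k - d k)"
        by (simp add: algebra_simps)
      then show ?thesis
        using val_ge_mult_right[OF a2[OF jk(1)] integral_familiesD(1)[OF int2 jk(2)]]
          val_ge_mult_left[OF d_int[OF jk(1)] a2[OF jk(2)]] by (simp add: val_ge_add)
    qed
    then have "val_ge (int m) (tr_form a b c j k - 2 * d j * d k - 2 * (a2 j * a2 k - d j * d k))"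
      using form[OF jk] by (simp only: val_ge_diff val_ge_two_mult_iff)
    then show ?thesis
      unfolding form2[symmetric] by (simp add: tr_form_def algebra_simps)
  qed
  then have "val_ge (int m) (b2 j * c1 k)" if "j \<in> I" "k \<in> I" for j k
    using val_ge_cross_products[OF val_two two_nz, of I "int m" b2 c1] that by blast
  then have "reducible_mod I m a2 b2 c1"
    using integral_familiesD[OF int2] by (intro reducible_mod_of_products)
  with conj_families_trans[OF conj1 conj2] show ?thesis
    by (rule reducible_mod_conj)
qed

text \<open>The family and d are both generalised in the induction on m, since each round divides
  both by p. A unit value of d settles the claim without the induction hypothesis.\<close>

theorem reducible_mod_of_tr_form:
  assumes "integral_families I a b c"
    and "\<And>i. i \<in> I \<Longrightarrow> val_ge 0 (d i)"
    and "\<And>i j. i \<in> I \<Longrightarrow> j \<in> I \<Longrightarrow> val_ge (int m) (tr_form a b c i j - 2 * d i * d j)"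
  shows "reducible_mod I m a b c"
  using assms
proof (induction m arbitrary: a b c d rule: less_induct)
  case (less m)
  note int = less.prems(1) and d_int = less.prems(2) and form = less.prems(3)
  show ?case
  proof (cases "m = 0")
    case True
    with int show ?thesis
      by (auto simp: integral_families_def intro!: reducible_modI[OF conj_families_refl])
  next
    case m0: False
    show ?thesis
    proof (cases "\<exists>i\<in>I. \<not> val_ge 1 (d i)")
      case True
      then obtain i where i: "i \<in> I" "\<not> val_ge 1 (d i)"
        by blast
      show ?thesis
      proof (cases "val_ge 1 (a i + d i)")
        case False
        with i show ?thesis
          by (intro reducible_mod_of_unit_sum[OF int, of d m i] d_int form)
      next
        case True
        \<comment> \<open>The hypothesis involves d only through products d i d j, so d may be
          replaced by -d. If p divided both a i + d i and a i - d i, it would divide 2 d i.\<close>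
        have "\<not> val_ge 1 (a i + - d i)"
          using val_ge_diff[OF True, of "a i + - d i"] i(2) val_ge_two_mult_iff[of 1 "d i"] by auto
        then show ?thesis
          using i form d_int by (intro reducible_mod_of_unit_sum[OF int, of "\<lambda>i. - d i" m i]) simp_all
      qed
    next
      case False
      then have d: "val_ge 1 (d i)" if "i \<in> I" for i
        using that by blast
      \<comment> \<open>The contribution of d is divisible by p^2, so the form itself vanishes
        modulo p^min(m, 2).\<close>
      have dd: "val_ge 2 (2 * d i * d j)" if "i \<in> I" "j \<in> I" for i j
        using val_ge_mult[OF d[OF that(1)] d[OF that(2)]] by (simp add: val_ge_two_mult_iff mult.assoc)
      have form_k: "val_ge k (tr_form a b c i j)" if "i \<in> I" "j \<in> I" "k \<le> int m" "k \<le> 2" for i j k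
        using val_ge_add[OF val_ge_mono[OF form[OF that(1,2)] that(3)]
            val_ge_mono[OF dd[OF that(1,2)] that(4)]] by simp
      have "val_ge 1 (tr_form a b c i j)" if "i \<in> I" "j \<in> I" for i j
        using form_k[OF that, of 1] m0 by simp
      then obtain a1 b1 c1 where
        conj1: "conj_families I (\<lambda>i. sl2 (a i) (b i) (c i)) (\<lambda>i. sl2 (a1 i) (b1 i) (c1 i))"
        and int1: "integral_families I a1 b1 c1"
        and c1: "\<And>i. i \<in> I \<Longrightarrow> val_ge 1 (c1 i)"
        and form1: "\<And>i j. tr_form a1 b1 c1 i j = tr_form a b c i j"
        using triangular_mod_p[OF int, of thesis] by blast
      show ?thesis
      \<comment> \<open>For m = 1 the triangular shape modulo p is already the claim. The argument
        for larger m reads the form modulo p^2.\<close>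
      proof (cases "m = 1")
        case True
        then show ?thesis
          using integral_familiesD[OF int1] c1 by (intro reducible_modI[OF conj1]) auto
      next
        case False
        with m0 have m2: "2 \<le> m"
          by simp
        \<comment> \<open>As p divides c1 i, the form at (i, i) is 2 a1 i^2 modulo p.\<close>
        have a1: "val_ge 1 (a1 i)" if i: "i \<in> I" for i
        proof -
          have "val_ge 1 (2 * (b1 i * c1 i))"
            using val_ge_mult_left[OF integral_familiesD(2)[OF int1 i] c1[OF i]]
            by (simp add: val_ge_two_mult_iff)
          then have "val_ge 1 (tr_form a1 b1 c1 i i - 2 * (b1 i * c1 i))"
            using form_k[OF i i, of 1] m2 form1 by (intro val_ge_diff) auto
          also have "tr_form a1 b1 c1 i i - 2 * (b1 i * c1 i) = 2 * (a1 i * a1 i)"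
            by (simp add: tr_form_def algebra_simps)
          finally show ?thesis
            using val_ge_square[of 1 "a1 i"] by (simp add: val_ge_two_mult_iff)
        qed
        have "val_ge 2 (b1 i * c1 j + b1 j * c1 i)" if ij: "i \<in> I" "j \<in> I" for i j
        proof -
          have "val_ge 2 (2 * (a1 i * a1 j))"
            using val_ge_mult[OF a1[OF ij(1)] a1[OF ij(2)]] by (simp add: val_ge_two_mult_iff)
          then have "val_ge 2 (tr_form a1 b1 c1 i j - 2 * (a1 i * a1 j))"
            using form_k[OF ij, of 2] m2 form1 by (intro val_ge_diff) auto
          then show ?thesis
            by (simp add: tr_form_def algebra_simps)
        qed
        then have bc: "val_ge 2 (b1 i * c1 j)" if "i \<in> I" "j \<in> I" for i j
          using val_ge_cross_products[OF val_two two_nz, of I 2 b1 c1] that by blast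
        have "\<exists>a2 b2 c2.
            conj_families I (\<lambda>i. sl2 (a1 i) (b1 i) (c1 i)) (\<lambda>i. sl2 (a2 i) (b2 i) (c2 i)) \<and>
            (\<forall>i\<in>I. val_ge 1 (a2 i) \<and> val_ge 1 (b2 i) \<and> val_ge 1 (c2 i)) \<and>
            (\<forall>i j. tr_form a2 b2 c2 i j = tr_form a b c i j)"
        proof (cases "\<forall>i\<in>I. val_ge 1 (b1 i)")
          case True
          with a1 c1 form1 show ?thesis
            by (intro exI[of _ a1] exI[of _ b1] exI[of _ c1]) (auto intro: conj_families_refl)
        next
          case False
          \<comment> \<open>A unit b1 i forces p^2 to divide every c1 j. Conjugating by diag(1, p)
            then moves one factor p to the upper right entries and leaves one behind.\<close>
          then obtain i where i: "i \<in> I" "\<not> val_ge 1 (b1 i)"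
            by blast
          have c2: "val_ge 2 (c1 j)" if "j \<in> I" for j
            using bc[OF i(1) that] val_ge_unit_mult_iff[OF integral_familiesD(2)[OF int1 i(1)] i(2)]
            by simp
          have "val_ge 1 (b1 j * p)" if "j \<in> I" for j
            using val_ge_mult_left[OF integral_familiesD(2)[OF int1 that], of 1 p]
            by (simp add: val_ge_def val_p)
          moreover have "val_ge 1 (c1 j / p)" if "j \<in> I" for j
            using c2[OF that] val_ge_divide_iff[OF p_nz, of 1 "c1 j"] by (simp add: val_p)
          ultimately show ?thesis
            using a1 form1 tr_form_diag[OF p_nz, of a1 b1 c1] conj_families_diag[OF p_nz, of I a1 b1 c1]
            by (intro exI[of _ a1] exI[of _ "\<lambda>i. b1 i * p"] exI[of _ "\<lambda>i. c1 i / p"])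
              (simp del: times_divide_eq_right)
        qed
        then obtain a2 b2 c2 where
          conj2: "conj_families I (\<lambda>i. sl2 (a1 i) (b1 i) (c1 i)) (\<lambda>i. sl2 (a2 i) (b2 i) (c2 i))"
          and abc2: "\<And>i. i \<in> I \<Longrightarrow> val_ge 1 (a2 i)" "\<And>i. i \<in> I \<Longrightarrow> val_ge 1 (b2 i)"
            "\<And>i. i \<in> I \<Longrightarrow> val_ge 1 (c2 i)"
          and form2: "\<And>i j. tr_form a2 b2 c2 i j = tr_form a b c i j"
          by blast
        have "reducible_mod I (m - 2) (\<lambda>i. a2 i / p) (\<lambda>i. b2 i / p) (\<lambda>i. c2 i / p)"
        proof (rule less.IH)
          show "m - 2 < m"
            using m2 by simp
          show "integral_families I (\<lambda>i. a2 i / p) (\<lambda>i. b2 i / p) (\<lambda>i. c2 i / p)"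
            using abc2 by (auto simp: integral_families_def val_ge_divide_iff[OF p_nz] val_p)
          show "val_ge 0 (d i / p)" if "i \<in> I" for i
            using d[OF that] by (simp add: val_ge_divide_iff[OF p_nz] val_p)
          show "val_ge (int (m - 2)) (tr_form (\<lambda>i. a2 i / p) (\<lambda>i. b2 i / p) (\<lambda>i. c2 i / p) i j
              - 2 * (d i / p) * (d j / p))" if "i \<in> I" "j \<in> I" for i j
          proof -
            have "tr_form (\<lambda>i. a2 i / p) (\<lambda>i. b2 i / p) (\<lambda>i. c2 i / p) i j
                - 2 * (d i / p) * (d j / p) = (tr_form a2 b2 c2 i j - 2 * d i * d j) / p / p"
              using p_nz by (simp add: tr_form_def field_simps)
            moreover have "int (m - 2) + 1 + 1 = int m"
              using m2 by simp
            ultimately show ?thesis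
              using form[OF that] by (simp only: val_ge_divide_iff[OF p_nz] val_p form2)
          qed
        qed
        then obtain a3 b3 c3 where
          conj3: "conj_families I (\<lambda>i. sl2 (a2 i / p) (b2 i / p) (c2 i / p))
            (\<lambda>i. sl2 (a3 i) (b3 i) (c3 i))"
          and abc3: "\<And>i. i \<in> I \<Longrightarrow> val_ge 0 (a3 i)" "\<And>i. i \<in> I \<Longrightarrow> val_ge 0 (b3 i)"
            "\<And>i. i \<in> I \<Longrightarrow> val_ge (int (m - 2)) (c3 i)"
          unfolding reducible_mod_def by auto
        have conj3': "conj_families I (\<lambda>i. sl2 (a2 i) (b2 i) (c2 i))
            (\<lambda>i. sl2 (p * a3 i) (p * b3 i) (p * c3 i))"
          using conj_families_scale[OF conj3, of p] p_nz by simp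
        \<comment> \<open>Scaling back by p gives only p^(m - 1) in the lower left. Conjugating by
          diag(1, 1/p) transfers the factor p of the upper right entries there and yields
          p^m.\<close>
        have conj4: "conj_families I (\<lambda>i. sl2 (p * a3 i) (p * b3 i) (p * c3 i))
            (\<lambda>i. sl2 (p * a3 i) (p * b3 i * inverse p) (p * c3 i / inverse p))"
          by (rule conj_families_diag) (simp add: p_nz)
        show ?thesis
        proof (rule reducible_modI)
          show "conj_families I (\<lambda>i. sl2 (a i) (b i) (c i))
              (\<lambda>i. sl2 (p * a3 i) (p * b3 i * inverse p) (p * c3 i / inverse p))"
            using conj_families_trans[OF conj_families_trans[OF conj1 conj2]
                conj_families_trans[OF conj3' conj4]] .
          show "val_ge 0 (p * a3 i)" if "i \<in> I" for i
            using abc3(1)[OF that] by (simp add: val_ge_mult_iff[OF p_nz] val_p val_ge_mono)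
          show "val_ge 0 (p * b3 i * inverse p)" if "i \<in> I" for i
            using abc3(2)[OF that] p_nz by (simp add: field_simps)
          show "val_ge (int m) (p * c3 i / inverse p)" if "i \<in> I" for i
          proof -
            have "p * c3 i / inverse p = p * (p * c3 i)"
              by (simp add: divide_inverse)
            then show ?thesis
              using abc3(3)[OF that] m2 by (simp add: val_ge_mult_iff[OF p_nz] val_p of_nat_diff)
          qed
        qed
      qed
    qed
  qed
qed

end


section \<open>Lattices given by bases\<close>

text \<open>The determinant of the matrix with columns a and b. It reads off coordinates, and its
  nonvanishing stands for linear independence over K.\<close>

definition wedge :: "'a::comm_ring_1^2 \<Rightarrow> 'a^2 \<Rightarrow> 'a" where
  "wedge a b = a $ 1 * b $ 2 - a $ 2 * b $ 1"

lemma vec2_eq_iff: "(a :: 'a^2) = b \<longleftrightarrow> a $ 1 = b $ 1 \<and> a $ 2 = b $ 2"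
  by (simp add: vec_eq_iff forall_2)

lemma wedge_comb_left: "wedge (s *s a + t *s b) b = s * wedge a b"
  by (simp add: wedge_def algebra_simps)

lemma wedge_comb_right: "wedge a (s *s a + t *s b) = t * wedge a b"
  by (simp add: wedge_def algebra_simps)

lemma wedge_cramer:
  fixes a b u :: "'a::field^2"
  assumes "wedge a b \<noteq> 0"
  shows "u = (wedge u b / wedge a b) *s a + (wedge a u / wedge a b) *s b"
  using assms by (simp add: vec2_eq_iff add_divide_distrib[symmetric] eq_divide_eq)
    (simp add: wedge_def algebra_simps)

context discretely_valued_field
begin

lemma carrier_val_ring_iff: "x \<in> carrier (val_ring v) \<longleftrightarrow> val_ge 0 x"
  by (simp add: val_ring_def val_ge_def)

definition lat_span :: "'k^2 \<Rightarrow> 'k^2 \<Rightarrow> ('k^2) set" where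
  "lat_span a b = {s *s a + t *s b |s t. val_ge 0 s \<and> val_ge 0 t}"

lemma lat_span_image:
  "lat_span a b = (\<lambda>(s, t). s *s a + t *s b) ` (carrier (val_ring v) \<times> carrier (val_ring v))"
  unfolding lat_span_def by (force simp: carrier_val_ring_iff)

lemma lat_spanI: "val_ge 0 s \<Longrightarrow> val_ge 0 t \<Longrightarrow> s *s a + t *s b \<in> lat_span a b"
  by (auto simp: lat_span_def)

lemma lat_span_basis: "a \<in> lat_span a b" "b \<in> lat_span a b"
  using lat_spanI[of 1 0 a b] lat_spanI[of 0 1 a b] by simp_all

lemma lat_span_add:
  assumes "x \<in> lat_span a b" "y \<in> lat_span a b"
  shows "x + y \<in> lat_span a b"
proof -
  obtain s t s' t' where "x = s *s a + t *s b" "val_ge 0 s" "val_ge 0 t"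
    "y = s' *s a + t' *s b" "val_ge 0 s'" "val_ge 0 t'"
    using assms by (auto simp: lat_span_def)
  then show ?thesis
    using lat_spanI[of "s + s'" "t + t'" a b]
    by (simp add: val_ge_add vector_sadd_rdistrib add_ac)
qed

lemma lat_span_scale:
  assumes "val_ge 0 q" "x \<in> lat_span a b"
  shows "q *s x \<in> lat_span a b"
proof -
  obtain s t where "x = s *s a + t *s b" "val_ge 0 s" "val_ge 0 t"
    using assms by (auto simp: lat_span_def)
  then show ?thesis
    using lat_spanI[of "q * s" "q * t" a b] assms(1)
    by (simp add: val_ge_mult_left vector_ssub_ldistrib vector_add_ldistrib vector_smult_assoc)
qed

lemma lat_span_subset_iff: "lat_span a b \<subseteq> lat_span a' b' \<longleftrightarrow> a \<in> lat_span a' b' \<and> b \<in> lat_span a' b'"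
proof
  assume "a \<in> lat_span a' b' \<and> b \<in> lat_span a' b'"
  then show "lat_span a b \<subseteq> lat_span a' b'"
    by (auto simp: lat_span_def[of a b] intro!: lat_span_add lat_span_scale)
qed (use lat_span_basis in blast)

lemma lat_span_comb_iff:
  assumes "wedge a b \<noteq> 0"
  shows "s *s a + t *s b \<in> lat_span a b \<longleftrightarrow> val_ge 0 s \<and> val_ge 0 t"
proof
  assume "s *s a + t *s b \<in> lat_span a b"
  then obtain s' t' where st: "s *s a + t *s b = s' *s a + t' *s b" "val_ge 0 s'" "val_ge 0 t'"
    by (auto simp: lat_span_def)
  have "s = s'" "t = t'"
    using arg_cong[OF st(1), of "\<lambda>u. wedge u b"] arg_cong[OF st(1), of "wedge a"] assms
    by (simp_all add: wedge_comb_left wedge_comb_right)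
  with st show "val_ge 0 s \<and> val_ge 0 t"
    by simp
qed (auto intro: lat_spanI)

lemma lat_span_swap: "lat_span a b = lat_span b a"
  by (metis lat_span_subset_iff lat_span_basis subset_antisym)

lemma lat_span_shear:
  assumes "val_ge 0 s"
  shows "lat_span (a + s *s b) b = lat_span a b"
proof
  show "lat_span (a + s *s b) b \<subseteq> lat_span a b"
    using assms by (simp add: lat_span_subset_iff lat_span_add lat_span_scale lat_span_basis)
  have "(a + s *s b) + (- s) *s b \<in> lat_span (a + s *s b) b"
    using assms by (intro lat_span_add lat_span_scale lat_span_basis) simp
  then show "lat_span a b \<subseteq> lat_span (a + s *s b) b"
    by (simp add: lat_span_subset_iff lat_span_basis)
qed

lemma lat_span_unit:
  assumes "e \<noteq> 0" "v e = 0"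
  shows "lat_span a (e *s b) = lat_span a b"
proof -
  have "val_ge 0 e" "val_ge 0 (inverse e)"
    using assms by (simp_all add: val_ge_def val_inverse)
  moreover have "b = inverse e *s (e *s b)"
    using assms by (simp add: vector_smult_assoc)
  ultimately have "b \<in> lat_span a (e *s b)" "e *s b \<in> lat_span a b"
    by (metis lat_span_scale lat_span_basis(2), metis lat_span_scale lat_span_basis(2))
  then show ?thesis
    by (intro equalityI) (simp_all add: lat_span_subset_iff lat_span_basis)
qed

lemma image_scale_lat_span: "(\<lambda>u. q *s u) ` lat_span a b = lat_span (q *s a) (q *s b)"
proof -
  have "q *s (s *s a + t *s b) = s *s (q *s a) + t *s (q *s b)" for s t
    by (simp add: vector_add_ldistrib vector_smult_assoc mult.commute)
  then show ?thesis
    by (force simp: lat_span_def image_iff)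
qed

lemma wedge_scale: "wedge (q *s a) (q *s b) = q * q * wedge a b"
  by (simp add: wedge_def algebra_simps)

text \<open>Linear independence over the field and over its valuation ring agree, because a relation can
  be divided by its coefficient of least valuation.\<close>

lemma lattice_basis_iff: "lattice_basis v a b L \<longleftrightarrow> L = lat_span a b \<and> wedge a b \<noteq> 0"
proof
  assume basis: "lattice_basis v a b L"
  let ?f = "\<lambda>(s, t). s *s a + t *s b" and ?R = "carrier (val_ring v)"
  have inj: "inj_on ?f (?R \<times> ?R)" and L: "L = lat_span a b"
    using basis unfolding lattice_basis_def bij_betw_def lat_span_image by auto
  have indep: "s = 0 \<and> t = 0" if "val_ge 0 s" "val_ge 0 t" "s *s a + t *s b = 0" for s t
    using inj_onD[OF inj, of "(s, t)" "(0, 0)"] that by (simp add: carrier_val_ring_iff)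
  have indep': "s = 0 \<and> t = 0" if st: "s *s a + t *s b = 0" for s t
  proof (rule ccontr)
    assume nz: "\<not> (s = 0 \<and> t = 0)"
    obtain q where q: "q \<noteq> 0" "val_ge (v q) s" "val_ge (v q) t"
    proof (cases "t = 0 \<or> (s \<noteq> 0 \<and> v s \<le> v t)")
      case True
      with nz show ?thesis
        by (intro that[of s]) (auto simp: val_ge_def)
    next
      case False
      then show ?thesis
        by (intro that[of t]) (auto simp: val_ge_def)
    qed
    have int: "val_ge 0 (s / q)" "val_ge 0 (t / q)"
      using q by (simp_all add: val_ge_divide_iff)
    have "(s / q) *s a + (t / q) *s b = inverse q *s (s *s a + t *s b)"
      by (simp add: vector_add_ldistrib vector_smult_assoc divide_inverse mult.commute)
    then have "(s / q) *s a + (t / q) *s b = 0"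
      unfolding st by simp
    with indep[OF int] q(1) nz show False
      by simp
  qed
  have "wedge a b \<noteq> 0"
  proof
    assume 0: "wedge a b = 0"
    \<comment> \<open>A vanishing determinant makes these two combinations relations, and their
      coefficients on b are the coordinates of a.\<close>
    then have "b $ 1 *s a + (- a $ 1) *s b = 0" "b $ 2 *s a + (- a $ 2) *s b = 0"
      by (simp_all add: vec2_eq_iff wedge_def mult.commute)
    then have "a = 0"
      using indep'[of "b $ 1" "- a $ 1"] indep'[of "b $ 2" "- a $ 2"] by (simp add: vec2_eq_iff)
    then show False
      using indep'[of 1 0] by simp
  qed
  with L show "L = lat_span a b \<and> wedge a b \<noteq> 0"
    by simp
next
  assume *: "L = lat_span a b \<and> wedge a b \<noteq> 0"
  have "inj_on (\<lambda>(s, t). s *s a + t *s b) (carrier (val_ring v) \<times> carrier (val_ring v))"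
  proof (rule inj_onI, clarify)
    fix s t s' t' assume eq: "s *s a + t *s b = s' *s a + t' *s b"
    show "s = s' \<and> t = t'"
      using arg_cong[OF eq, of "\<lambda>u. wedge u b"] arg_cong[OF eq, of "wedge a"] *
      by (simp_all add: wedge_comb_left wedge_comb_right)
  qed
  with * show "lattice_basis v a b L"
    by (simp add: lattice_basis_def bij_betw_def lat_span_image)
qed

lemma lattices_iff: "L \<in> lattices v \<longleftrightarrow> (\<exists>a b. L = lat_span a b \<and> wedge a b \<noteq> 0)"
proof -
  have "vec.span (lat_span a b) = UNIV" if "wedge a b \<noteq> 0" for a b
  proof -
    have "(wedge u b / wedge a b) *s a + (wedge a u / wedge a b) *s b \<in> vec.span (lat_span a b)" for u
      by (intro vec.span_add vec.span_scale vec.span_base lat_span_basis)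
    then show ?thesis
      unfolding wedge_cramer[OF that, symmetric] by blast
  qed
  then show ?thesis
    unfolding lattices_def lattice_basis_iff by blast
qed

lemma lattices_lat_span: "wedge a b \<noteq> 0 \<Longrightarrow> lat_span a b \<in> lattices v"
  by (auto simp: lattices_iff)

lemma lattices_scale: "L \<in> lattices v \<Longrightarrow> q \<noteq> 0 \<Longrightarrow> (\<lambda>u. q *s u) ` L \<in> lattices v"
  unfolding lattices_iff using image_scale_lat_span wedge_scale by (metis mult_eq_0_iff)

section \<open>Homothety classes of lattices\<close>

lemma homothety_iff:
  "(L, M) \<in> homothety v \<longleftrightarrow> L \<in> lattices v \<and> (\<exists>q. q \<noteq> 0 \<and> M = (\<lambda>u. q *s u) ` L)"
  unfolding homothety_def using lattices_scale by blast

lemma image_scale_scale: "(\<lambda>u. q *s u) ` (\<lambda>u. r *s u) ` L = (\<lambda>u. (q * r) *s (u::'k^2)) ` L"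
  by (simp add: image_image vector_smult_assoc)

lemma equiv_homothety: "equiv (lattices v) (homothety v)"
proof (rule equivI)
  show "homothety v \<subseteq> lattices v \<times> lattices v"
    unfolding homothety_def by blast
  show "refl_on (lattices v) (homothety v)"
  proof (rule refl_onI)
    fix L assume "L \<in> lattices v"
    moreover have "L = (\<lambda>u. 1 *s u) ` L"
      by simp
    ultimately show "(L, L) \<in> homothety v"
      unfolding homothety_iff using one_neq_zero by blast
  qed
  show "sym (homothety v)"
  proof (rule symI)
    fix L M assume "(L, M) \<in> homothety v"
    then obtain q where q: "L \<in> lattices v" "q \<noteq> 0" "M = (\<lambda>u. q *s u) ` L"
      unfolding homothety_iff by blast
    have "L = (\<lambda>u. inverse q *s u) ` M"
      unfolding q(3) image_scale_scale using q(2) by simp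
    moreover have "M \<in> lattices v"
      unfolding q(3) using lattices_scale[OF q(1,2)] .
    moreover have "inverse q \<noteq> 0"
      using q(2) by simp
    ultimately show "(M, L) \<in> homothety v"
      unfolding homothety_iff by blast
  qed
  show "trans (homothety v)"
  proof (rule transI)
    fix L M N assume "(L, M) \<in> homothety v" "(M, N) \<in> homothety v"
    then obtain q r where "L \<in> lattices v" "q \<noteq> 0" "M = (\<lambda>u. q *s u) ` L"
      "r \<noteq> 0" "N = (\<lambda>u. r *s u) ` M"
      unfolding homothety_iff by blast
    then show "(L, N) \<in> homothety v"
      unfolding homothety_iff by (metis image_scale_scale mult_eq_0_iff)
  qed
qed

lemma homothety_class_iff:
  "L \<in> lattices v \<Longrightarrow> M \<in> homothety v `` {L} \<longleftrightarrow> (\<exists>q. q \<noteq> 0 \<and> M = (\<lambda>u. q *s u) ` L)"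
  by (simp add: homothety_iff)

lemma vertexE:
  assumes "x \<in> vertices v"
  obtains L where "L \<in> lattices v" "x = homothety v `` {L}" "L \<in> x"
proof -
  obtain L where L: "L \<in> lattices v" "x = homothety v `` {L}"
    using assms unfolding vertices_def by (auto elim: quotientE)
  with equiv_class_self[OF equiv_homothety] show ?thesis
    using that by blast
qed

lemma vertexI: "L \<in> lattices v \<Longrightarrow> homothety v `` {L} \<in> vertices v"
  unfolding vertices_def by (rule quotientI)


section \<open>The distance in the tree\<close>

text \<open>Containment is tested on the two basis vectors. Into \<open>lat_span a (e *s b)\<close>
  the vector b is the obstruction and asks for v e; in the other direction it is a, since e is
  integral.\<close>

lemma scale_subset_iff:
  assumes "wedge a b \<noteq> 0" "e \<noteq> 0" "0 \<le> v e"
  shows "(\<lambda>u. q *s u) ` lat_span a b \<subseteq> lat_span a (e *s b) \<longleftrightarrow> val_ge (v e) q"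
    and "(\<lambda>u. q *s u) ` lat_span a (e *s b) \<subseteq> lat_span a b \<longleftrightarrow> val_ge 0 q"
proof -
  have w: "wedge a (e *s b) \<noteq> 0"
    using assms by (simp add: wedge_def algebra_simps)
  have "q *s b = 0 *s a + (q / e) *s (e *s b)" "q *s a = q *s a + 0 *s (e *s b)"
    using assms(2) by (simp_all add: vector_smult_assoc)
  then have "q *s b \<in> lat_span a (e *s b) \<longleftrightarrow> val_ge 0 (q / e)"
    "q *s a \<in> lat_span a (e *s b) \<longleftrightarrow> val_ge 0 q"
    using lat_span_comb_iff[OF w] val_ge_zero by metis+
  then show "(\<lambda>u. q *s u) ` lat_span a b \<subseteq> lat_span a (e *s b) \<longleftrightarrow> val_ge (v e) q"
    using assms val_ge_mono[of "v e" q 0]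
    by (auto simp: image_scale_lat_span lat_span_subset_iff val_ge_divide_iff)
  have "q *s (e *s b) = 0 *s a + (q * e) *s b" "q *s a = q *s a + 0 *s b"
    by (simp_all add: vector_smult_assoc)
  then have "q *s (e *s b) \<in> lat_span a b \<longleftrightarrow> val_ge 0 (q * e)"
    "q *s a \<in> lat_span a b \<longleftrightarrow> val_ge 0 q"
    using lat_span_comb_iff[OF assms(1)] val_ge_zero by metis+
  moreover have "val_ge 0 e"
    using assms(3) by (simp add: val_ge_def)
  ultimately show "(\<lambda>u. q *s u) ` lat_span a (e *s b) \<subseteq> lat_span a b \<longleftrightarrow> val_ge 0 q"
    by (auto simp: image_scale_lat_span lat_span_subset_iff val_ge_mult_right)
qed

text \<open>The two conductors \<open>{q. q L \<subseteq> M}\<close> and \<open>{q. q M \<subseteq> L}\<close> determine the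
  elementary divisors; rescaling \<open>L\<close> and \<open>M\<close> shifts them in opposite directions.\<close>

lemma elementary_divisor_unique:
  assumes w: "wedge a b \<noteq> 0" "wedge a' b' \<noteq> 0"
    and e: "e \<noteq> 0" "0 \<le> v e" "e' \<noteq> 0" "0 \<le> v e'" and qr: "q \<noteq> 0" "r \<noteq> 0"
    and L: "(\<lambda>u. q *s u) ` lat_span a b = lat_span a' b'"
    and M: "(\<lambda>u. r *s u) ` lat_span a (e *s b) = lat_span a' (e' *s b')"
  shows "v e = v e'"
proof -
  have shift: "(\<lambda>u. z *s u) ` (\<lambda>u. x *s u) ` A \<subseteq> (\<lambda>u. y *s u) ` B \<longleftrightarrow>
      (\<lambda>u. (z * x / y) *s u) ` A \<subseteq> B" if y: "y \<noteq> 0" for x y z and A B :: "('k^2) set"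
  proof -
    have "(\<lambda>u. (z * x / y) *s u) ` A = (\<lambda>u. inverse y *s u) ` (\<lambda>u. z *s u) ` (\<lambda>u. x *s u) ` A"
      by (simp add: image_image vector_smult_assoc divide_inverse mult_ac)
    moreover have "B = (\<lambda>u. inverse y *s u) ` (\<lambda>u. y *s u) ` B"
      using y by (simp add: image_image vector_smult_assoc)
    moreover have "inj (\<lambda>u::'k^2. inverse y *s u)"
      using y by (auto intro!: injI simp: vec2_eq_iff)
    ultimately show ?thesis
      by (metis inj_image_subset_iff)
  qed
  have 1: "val_ge (v e') z \<longleftrightarrow> val_ge (v e) (z * q / r)" for z
    using scale_subset_iff(1)[OF w(1) e(1,2), of "z * q / r"]
      scale_subset_iff(1)[OF w(2) e(3,4), of z]
    by (simp only: shift[OF qr(2)] flip: L M)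
  have 2: "val_ge 0 z \<longleftrightarrow> val_ge 0 (z * r / q)" for z
    using scale_subset_iff(2)[OF w(1) e(1,2), of "z * r / q"]
      scale_subset_iff(2)[OF w(2) e(3,4), of z]
    by (simp only: shift[OF qr(1)] flip: L M)
  \<comment> \<open>Each equivalence compares two fractional ideals and is tested on generators: z =
    1 and z = q / r give v q = v r, then z = e and z = e' give v e = v e'.\<close>
  have qr': "v q = v r"
    using 2[of 1] 2[of "q / r"] qr by (simp add: val_ge_divide_iff) (simp add: val_ge_def)
  then show ?thesis
    using 1[of e] 1[of e'] qr e by (simp add: val_ge_divide_iff) (simp add: val_ge_def val_mult)
qed

lemma exists_least_valuation:
  assumes "finite S" "\<exists>x\<in>S. x \<noteq> 0"
  obtains x where "x \<in> S" "x \<noteq> 0" "\<And>y. y \<in> S \<Longrightarrow> val_ge 0 (y / x)"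
proof -
  have fin: "finite (v ` (S - {0}))" "v ` (S - {0}) \<noteq> {}"
    using assms by auto
  obtain x where x: "x \<in> S" "x \<noteq> 0" "v x = Min (v ` (S - {0}))"
  proof -
    obtain x where "Min (v ` (S - {0})) = v x" "x \<in> S - {0}"
      using Min_in[OF fin] by (rule imageE)
    then show thesis
      using that[of x] by simp
  qed
  have "val_ge 0 (y / x)" if "y \<in> S" for y
  proof (cases "y = 0")
    case False
    then have "v x \<le> v y"
      unfolding x(3) using fin(1) that by (intro Min_le) auto
    then show ?thesis
      using x(2) by (simp add: val_ge_divide_iff) (simp add: val_ge_def)
  qed simp
  with x show ?thesis
    using that by blast
qed

text \<open>Smith normal form over a valuation ring: an entry of least valuation divides all others,
  so one row and one column operation diagonalise. Rescaling M by its inverse makes the first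
  elementary divisor 1.\<close>

lemma elementary_divisor_exists:
  assumes "L \<in> lattices v" "M \<in> lattices v"
  obtains q e a b where "q \<noteq> 0" "e \<noteq> 0" "0 \<le> v e" "wedge a b \<noteq> 0"
    "L = lat_span a b" "(\<lambda>u. q *s u) ` M = lat_span a (e *s b)"
proof -
  define good where "good L M \<longleftrightarrow> (\<exists>q e a b. q \<noteq> 0 \<and> e \<noteq> 0 \<and> 0 \<le> v e \<and> wedge a b \<noteq> 0 \<and>
    L = lat_span a b \<and> (\<lambda>u. q *s u) ` M = lat_span a (e *s b))" for L M
  have pivot: "good (lat_span a b) (lat_span (x *s a + y *s b) (z *s a + w *s b))"
    if wab: "wedge a b \<noteq> 0" and det: "x * w - y * z \<noteq> 0" and x: "x \<noteq> 0"
      and int: "val_ge 0 (y / x)" "val_ge 0 (z / x)" "val_ge 0 (w / x)" for a b x y z w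
  proof -
    \<comment> \<open>a' is (x a + y b) / x, a basis vector of L and of the rescaled M. The divisor
      e is the rescaled determinant (x w - y z) / x^2.\<close>
    define a' where "a' = a + (y / x) *s b"
    define e where "e = w / x - (z / x) * (y / x)"
    have e0: "e \<noteq> 0"
      using det x by (auto simp: e_def field_simps)
    have "val_ge 0 e"
      unfolding e_def by (intro val_ge_diff val_ge_mult_left int)
    with e0 have ve: "0 \<le> v e"
      by (simp add: val_ge_def)
    have 1: "inverse x *s (x *s a + y *s b) = a'"
      using x by (simp add: a'_def vector_add_ldistrib vector_smult_assoc field_simps)
    have 2: "inverse x *s (z *s a + w *s b) = e *s b + (z / x) *s a'"
      using x by (simp add: a'_def e_def vec2_eq_iff field_simps)
    have "(\<lambda>u. inverse x *s u) ` lat_span (x *s a + y *s b) (z *s a + w *s b) = lat_span a' (e *s b)"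
      unfolding image_scale_lat_span 1 2
      using lat_span_shear[OF int(2), of "e *s b" a'] by (simp add: lat_span_swap)
    moreover have "lat_span a b = lat_span a' b"
      unfolding a'_def using lat_span_shear[OF int(1)] by simp
    moreover have "wedge a' b \<noteq> 0"
      using wab by (simp add: a'_def wedge_def algebra_simps)
    ultimately show ?thesis
      unfolding good_def using e0 ve x
      by (intro exI[of _ "inverse x"] exI[of _ e] exI[of _ a'] exI[of _ b]) simp
  qed
  obtain a b c d where L: "L = lat_span a b" "wedge a b \<noteq> 0" and M: "M = lat_span c d" "wedge c d \<noteq> 0"
    using assms by (auto simp: lattices_iff)
  obtain x y where c: "c = x *s a + y *s b"
    using wedge_cramer[OF L(2)] by blast
  obtain z w where d: "d = z *s a + w *s b"
    using wedge_cramer[OF L(2)] by blast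
  have "wedge c d = (x * w - y * z) * wedge a b"
    by (simp add: c d wedge_def algebra_simps)
  then have det: "x * w - y * z \<noteq> 0"
    using M(2) by auto
  obtain m where m: "m \<in> {x, y, z, w}" "m \<noteq> 0" "\<And>u. u \<in> {x, y, z, w} \<Longrightarrow> val_ge 0 (u / m)"
    by (rule exists_least_valuation[of "{x, y, z, w}"]) (use det in auto)
  have wba: "wedge b a \<noteq> 0"
    using L(2) by (auto simp: wedge_def algebra_simps)
  have c': "c = y *s b + x *s a" and d': "d = w *s b + z *s a"
    by (simp_all add: c d add.commute)
  have "good L M"
  proof -
    \<comment> \<open>The other pivot positions reduce to the first by swapping the basis of L, that
      of M, or both.\<close>
    consider "m = x" | "m = y" | "m = z" | "m = w"
      using m(1) by blast
    then show ?thesis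
    proof cases
      case 1
      with m det L show ?thesis
        unfolding M c d using pivot[of a b x w y z] by simp
    next
      case 2
      with m det L wba show ?thesis
        unfolding M c' d' using pivot[of b a y z x w] by (simp add: lat_span_swap mult.commute)
    next
      case 3
      with m det L show ?thesis
        unfolding M lat_span_swap[of c d] unfolding c d
        using pivot[of a b z y w x] by (simp add: mult.commute)
    next
      case 4
      with m det L wba show ?thesis
        unfolding M lat_span_swap[of c d] unfolding c' d'
        using pivot[of b a w x z y] by (simp add: lat_span_swap mult.commute)
    qed
  qed
  then show ?thesis
    using that unfolding good_def by blast
qed

lemma vertex_members:
  assumes "x \<in> vertices v" "L \<in> x" "M \<in> x"
  shows "\<exists>q. q \<noteq> 0 \<and> M = (\<lambda>u. q *s u) ` L"
proof -
  obtain L0 where L0: "x = homothety v `` {L0}"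
    using assms(1) by (rule vertexE)
  have "(L0, L) \<in> homothety v" "(L0, M) \<in> homothety v"
    using assms(2,3) by (simp_all add: L0)
  then have "(L, M) \<in> homothety v"
    using equiv_homothety by (auto elim: equivE dest: symD transD)
  then show ?thesis
    by (simp only: homothety_iff)
qed

lemma vertex_scale:
  assumes "x \<in> vertices v" "L \<in> x" "q \<noteq> 0"
  shows "(\<lambda>u. q *s u) ` L \<in> x"
proof -
  obtain L0 where L0: "L0 \<in> lattices v" "x = homothety v `` {L0}"
    using assms(1) by (rule vertexE)
  have "\<exists>r. r \<noteq> 0 \<and> L = (\<lambda>u. r *s u) ` L0"
    using assms(2) unfolding L0(2) homothety_class_iff[OF L0(1)] .
  then obtain r where r: "r \<noteq> 0" "L = (\<lambda>u. r *s u) ` L0"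
    by (elim exE conjE)
  show ?thesis
    unfolding L0(2) homothety_class_iff[OF L0(1)] r(2) image_scale_scale
    using r(1) assms(3) by (intro exI[of _ "q * r"]) simp
qed

text \<open>Other representatives differ by homotheties, and these leave the exponent of the
  elementary divisor unchanged.\<close>

lemma vertex_dist_eqI:
  assumes p: "uniformiser v p" and xy: "x \<in> vertices v" "y \<in> vertices v" "L \<in> x" "M \<in> y"
    and basis: "lattice_basis v a b L" "lattice_basis v a (p ^ d *s b) M"
  shows "vertex_dist v p x y = d"
  unfolding vertex_dist_def
proof (rule the_equality)
  show "\<exists>L\<in>x. \<exists>M\<in>y. \<exists>a b. lattice_basis v a b L \<and> lattice_basis v a (p ^ d *s b) M"
    using xy basis by blast
next
  fix d' assume "\<exists>L\<in>x. \<exists>M\<in>y. \<exists>a b. lattice_basis v a b L \<and> lattice_basis v a (p ^ d' *s b) M"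
  then obtain L' M' a' b' where L': "L' \<in> x" "M' \<in> y"
    and basis': "lattice_basis v a' b' L'" "lattice_basis v a' (p ^ d' *s b') M'"
    by blast
  obtain q where q: "q \<noteq> 0" "L' = (\<lambda>u. q *s u) ` L"
    using vertex_members[OF xy(1,3) L'(1)] by (elim exE conjE)
  obtain r where r: "r \<noteq> 0" "M' = (\<lambda>u. r *s u) ` M"
    using vertex_members[OF xy(2,4) L'(2)] by (elim exE conjE)
  note pp = val_uniformiser_power[OF p]
  have "v (p ^ d) = v (p ^ d')"
  proof (rule elementary_divisor_unique)
    show "wedge a b \<noteq> 0" "wedge a' b' \<noteq> 0"
      using basis(1) basis'(1) by (simp_all add: lattice_basis_iff)
    show "(\<lambda>u. q *s u) ` lat_span a b = lat_span a' b'"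
      using q basis(1) basis'(1) by (simp add: lattice_basis_iff)
    show "(\<lambda>u. r *s u) ` lat_span a (p ^ d *s b) = lat_span a' (p ^ d' *s b')"
      using r basis(2) basis'(2) by (simp add: lattice_basis_iff)
  qed (simp_all only: pp q r, simp_all)
  then show "d' = d"
    by (simp add: pp)
qed

text \<open>The definite description is attained: changing the elementary divisor by a unit does not
  change the lattice, so a power of p may be taken.\<close>

lemma vertex_dist_bases:
  assumes p: "uniformiser v p" and xy: "x \<in> vertices v" "y \<in> vertices v"
  obtains L M a b where "L \<in> x" "M \<in> y" "lattice_basis v a b L"
    "lattice_basis v a (p ^ vertex_dist v p x y *s b) M"
proof -
  obtain L M0 where L: "L \<in> lattices v" "L \<in> x" and M0: "M0 \<in> lattices v" "M0 \<in> y"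
  proof -
    obtain L where L: "L \<in> lattices v" "L \<in> x"
      using xy(1) by (rule vertexE)
    obtain M where "M \<in> lattices v" "M \<in> y"
      using xy(2) by (rule vertexE)
    with L show thesis
      by (rule that)
  qed
  obtain q e a b where q: "q \<noteq> 0" and e: "e \<noteq> 0" "0 \<le> v e" and w: "wedge a b \<noteq> 0"
    and La: "L = lat_span a b" and Ma: "(\<lambda>u. q *s u) ` M0 = lat_span a (e *s b)"
    by (rule elementary_divisor_exists[OF L(1) M0(1)])
  define d where "d = nat (v e)"
  note pp = val_uniformiser_power[OF p, of d]
  have "v (e / p ^ d) + v (p ^ d) = v e"
    using val_mult[of "e / p ^ d" "p ^ d"] e pp by simp
  then have "v (e / p ^ d) = 0"
    using pp e by (simp add: d_def)
  then have "lat_span a (e *s b) = lat_span a (p ^ d *s b)"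
    using lat_span_unit[of "e / p ^ d" a "p ^ d *s b"] e pp by (simp add: vector_smult_assoc)
  with Ma have M: "lattice_basis v a (p ^ d *s b) ((\<lambda>u. q *s u) ` M0)"
    using w pp by (simp add: lattice_basis_iff wedge_def algebra_simps)
  have "lattice_basis v a b L"
    using La w by (simp add: lattice_basis_iff)
  moreover have "(\<lambda>u. q *s u) ` M0 \<in> y"
    by (rule vertex_scale[OF xy(2) M0(2) q])
  moreover have "vertex_dist v p x y = d"
    by (rule vertex_dist_eqI[OF p xy]) fact+
  ultimately show ?thesis
    using that[OF L(2), of "(\<lambda>u. q *s u) ` M0" a b] M by simp
qed

end


section \<open>Residue rings\<close>

context discretely_valued_field
begin

lemma PIdl_uniformiser_power:
  assumes "uniformiser v p"
  shows "PIdl\<^bsub>val_ring v\<^esub> (p ^ n) = {x. val_ge (int n) x}"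
proof -
  note p = val_uniformiser_power[OF assms, of n]
  have "val_ge (int n) x \<longleftrightarrow> (\<exists>s. val_ge 0 s \<and> x = s * p ^ n)" for x
  proof
    assume "val_ge (int n) x"
    then show "\<exists>s. val_ge 0 s \<and> x = s * p ^ n"
      using p by (intro exI[of _ "x / p ^ n"]) (simp add: val_ge_divide_iff)
  next
    assume "\<exists>s. val_ge 0 s \<and> x = s * p ^ n"
    then show "val_ge (int n) x"
      using p val_ge_mult_iff[of "p ^ n" "int n"] by (auto simp: mult.commute)
  qed
  then show ?thesis
    by (auto simp: cgenideal_def carrier_val_ring_iff) (auto simp: val_ring_def)
qed

lemma ideal_PIdl_uniformiser_power:
  assumes "uniformiser v p"
  shows "ideal (PIdl\<^bsub>val_ring v\<^esub> (p ^ n)) (val_ring v)"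
proof -
  interpret cring "val_ring v"
    by (rule cring_val_ring)
  show ?thesis
    using val_uniformiser_power[OF assms, of n]
    by (intro cgenideal_ideal) (simp add: carrier_val_ring_iff val_ge_def)
qed

lemma residue_class_ring_hom:
  "uniformiser v p \<Longrightarrow> residue_class v p n \<in> ring_hom (val_ring v) (residue_ring_pow v p n)"
  using ideal.rcos_ring_hom[OF ideal_PIdl_uniformiser_power, of p n]
  unfolding residue_class_def residue_ring_pow_def by (simp add: eta_contract_eq)

lemma ring_residue_ring_pow: "uniformiser v p \<Longrightarrow> ring (residue_ring_pow v p n)"
  unfolding residue_ring_pow_def
  by (intro ideal.quotient_is_ring ideal_PIdl_uniformiser_power)

lemma residue_class_simps:
  assumes "uniformiser v p"
  shows residue_class_closed: "val_ge 0 x \<Longrightarrow> residue_class v p n x \<in> carrier (residue_ring_pow v p n)"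
    and residue_class_mult: "val_ge 0 x \<Longrightarrow> val_ge 0 y \<Longrightarrow>
      residue_class v p n (x * y) =
      residue_class v p n x \<otimes>\<^bsub>residue_ring_pow v p n\<^esub> residue_class v p n y"
    and residue_class_add: "val_ge 0 x \<Longrightarrow> val_ge 0 y \<Longrightarrow>
      residue_class v p n (x + y) =
      residue_class v p n x \<oplus>\<^bsub>residue_ring_pow v p n\<^esub> residue_class v p n y"
    and residue_class_one: "residue_class v p n 1 = \<one>\<^bsub>residue_ring_pow v p n\<^esub>"
  using ring_hom_closed[OF residue_class_ring_hom[OF assms], of x n]
    ring_hom_mult[OF residue_class_ring_hom[OF assms], of x y n]
    ring_hom_add[OF residue_class_ring_hom[OF assms], of x y n]
    ring_hom_one[OF residue_class_ring_hom[OF assms], of n]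
  by (simp_all add: carrier_val_ring_iff) (simp_all add: val_ring_def)

lemma residue_class_eq_iff:
  assumes "uniformiser v p" "val_ge 0 x" "val_ge 0 y"
  shows "residue_class v p n x = residue_class v p n y \<longleftrightarrow> val_ge (int n) (x - y)"
proof -
  interpret cring "val_ring v"
    by (rule cring_val_ring)
  have xy: "x \<in> carrier (val_ring v)" "y \<in> carrier (val_ring v)" "- y \<in> carrier (val_ring v)"
    using assms(2,3) by (simp_all add: carrier_val_ring_iff)
  have "\<ominus>\<^bsub>val_ring v\<^esub> y = - y"
    using xy by (intro minus_equality) (simp_all add: val_ring_def)
  then have "x \<ominus>\<^bsub>val_ring v\<^esub> y = x - y"
    by (simp add: a_minus_def) (simp add: val_ring_def)
  then show ?thesis
    using quotient_eq_iff_same_a_r_cos[OF ideal_PIdl_uniformiser_power[OF assms(1), of n] xy(1,2)]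
    by (simp add: residue_class_def PIdl_uniformiser_power[OF assms(1)])
qed

lemma residue_class_zero:
  assumes "uniformiser v p"
  shows "residue_class v p n 0 = \<zero>\<^bsub>residue_ring_pow v p n\<^esub>"
proof -
  interpret ring "residue_ring_pow v p n"
    by (rule ring_residue_ring_pow[OF assms])
  show ?thesis
    using residue_class_add[OF assms, of 0 0 n] residue_class_closed[OF assms, of 0 n]
    by (simp add: add.l_cancel_one)
qed

lemma residue_class_surj:
  assumes "X \<in> carrier (residue_ring_pow v p n)"
  obtains x where "val_ge 0 x" "X = residue_class v p n x"
  using assms unfolding residue_ring_pow_def FactRing_def residue_class_def
  by (auto simp: A_RCOSETS_def' carrier_val_ring_iff)

text \<open>If p divided 2, the multiple k of 1 would vanish in the residue field exactly for even
  k, and the additive order of 1 would be 2.\<close>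

lemma val_two_of_residue_characteristic:
  assumes p: "uniformiser v p" and char: "ring_characteristic (residue_ring_pow v p 1) \<noteq> 2"
  shows "(2::'k) \<noteq> 0" "v 2 = 0"
proof -
  let ?Q = "residue_ring_pow v p 1"
  interpret Q: ring ?Q
    by (rule ring_residue_ring_pow[OF p])
  have nat_ge: "val_ge 0 (of_nat k)" for k
    by (induction k) (simp_all add: val_ge_add)
  have pow: "add_pow ?Q k \<one>\<^bsub>?Q\<^esub> = residue_class v p 1 (of_nat k)" for k :: nat
  proof (induction k)
    case (Suc k)
    then show ?case
      using residue_class_add[OF p nat_ge[of k], of 1 1] Q.add.nat_pow_Suc
      by (simp add: residue_class_one[OF p] add.commute)
  qed (use Q.add.nat_pow_0 in \<open>simp add: residue_class_zero[OF p]\<close>)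
  have "\<not> val_ge 1 2"
  proof
    assume 2: "val_ge 1 2"
    have "residue_class v p 1 (of_nat k) = \<zero>\<^bsub>?Q\<^esub> \<longleftrightarrow> 2 dvd k" for k :: nat
    proof -
      have "val_ge 1 (of_nat k) \<longleftrightarrow> 2 dvd k"
      proof
        assume k: "val_ge 1 (of_nat k)"
        show "2 dvd k"
        proof (rule ccontr)
          assume "\<not> 2 dvd k"
          then obtain l where "k = 2 * l + 1"
            by (auto elim: oddE)
          with k have "val_ge 1 (1 + 2 * of_nat l)"
            by (simp add: add.commute)
          moreover have "val_ge 1 (2 * of_nat l)"
            using val_ge_mult_right[OF 2 nat_ge] .
          ultimately have "val_ge 1 1"
            using val_ge_diff by fastforce
          then show False
            by (simp add: val_ge_def val_one)
        qed
      next
        assume "2 dvd k"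
        then obtain l where "k = 2 * l" ..
        then show "val_ge 1 (of_nat k)"
          using val_ge_mult_right[OF 2 nat_ge[of l]] by simp
      qed
      then show ?thesis
        using residue_class_eq_iff[OF p nat_ge[of k] val_ge_zero, of 1] by (simp add: residue_class_zero[OF p])
    qed
    then have "\<forall>k. \<one>\<^bsub>?Q\<^esub> [^]\<^bsub>add_monoid ?Q\<^esub> (k::nat) = \<one>\<^bsub>add_monoid ?Q\<^esub> \<longleftrightarrow> 2 dvd k"
      using pow by (simp add: add_pow_def)
    with Q.one_closed have "group.ord (add_monoid ?Q) \<one>\<^bsub>?Q\<^esub> = 2"
      by (subst group.ord_unique[OF Q.a_group]) simp_all
    with char show False
      by (simp add: ring_characteristic_def)
  qed
  moreover have "val_ge 0 2"
    using nat_ge[of 2] by simp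
  ultimately show "(2::'k) \<noteq> 0" "v 2 = 0"
    using val_ge_unit by blast+
qed

end


section \<open>Stable lattices\<close>

text \<open>Multiplicativity makes the image of the identity an invertible idempotent.\<close>

lemma (in group) GL2_hom_one:
  fixes \<rho> :: "'a \<Rightarrow> 'k::field^2^2"
  assumes hom: "\<rho> \<in> hom G GL2"
  shows "\<rho> \<one> = mat 1"
proof -
  obtain B where "B ** \<rho> \<one> = mat 1"
    using hom_in_carrier[OF hom one_closed] by (auto simp: GL2_def invertible_def)
  moreover have "\<rho> \<one> ** \<rho> \<one> = \<rho> \<one>"
    using hom_mult[OF hom one_closed one_closed] by (simp add: GL2_def)
  ultimately show ?thesis
    by (metis matrix_mul_assoc matrix_mul_lid)
qed

context discretely_valued_field
begin

lemma val_bounded_of_compactin: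
  assumes "compactin (val_topology v) S"
  obtains k where "\<And>x. x \<in> S \<Longrightarrow> val_ge k x"
proof -
  interpret Metric_space UNIV "val_dist v"
    by (rule Metric_space_val_dist)
  have "mbounded S"
    using assms unfolding val_topology_def by (rule compactin_imp_mbounded)
  \<comment> \<open>0 is adjoined so that the bound on distances controls the distance to 0, that
    is, the valuation.\<close>
  then have "mbounded (insert 0 S)"
    by (simp add: mbounded_insert)
  then obtain B where B: "\<And>x. x \<in> S \<Longrightarrow> val_dist v x 0 \<le> B"
    unfolding mbounded_alt by blast
  obtain N :: nat where N: "B < 2 ^ N"
    using real_arch_pow[of 2 B] by auto
  have "val_ge (- int N) x" if "x \<in> S" for x
  proof (rule ccontr)
    assume "\<not> val_ge (- int N) x"
    then have "x \<noteq> 0" and N': "int N \<le> - v x"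
      by (auto simp: val_ge_def)
    from N' have le: "(2::real) powi (int N) \<le> 2 powi (- v x)"
      by (intro power_int_increasing) simp_all
    have "val_dist v x 0 = 2 powi (- v x)"
      using \<open>x \<noteq> 0\<close> by (simp add: val_dist_def)
    with le have "2 ^ N \<le> val_dist v x 0"
      by simp
    with B[OF that] N show False
      by simp
  qed
  then show ?thesis
    using that by blast
qed

lemma continuous_rep_bounded:
  assumes "compact_group G T" "continuous_rep G T v \<rho>"
  obtains k where "\<And>g i j. g \<in> carrier G \<Longrightarrow> val_ge k (\<rho> g $ i $ j)"
proof -
  interpret compact_group G T
    by fact
  have cont: "continuous_map T (GL2_topology v) \<rho>"
    using assms(2) by (simp add: continuous_rep_def)
  have "\<exists>k. \<forall>g\<in>carrier G. val_ge k (\<rho> g $ i $ j)" for i j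
  proof -
    have proj: "continuous_map (product_topology (\<lambda>_. val_topology v) (UNIV :: (2 \<times> 2) set))
        (val_topology v) (\<lambda>x. x (i, j))"
      using continuous_map_product_coordinates[of "(i, j)" UNIV "\<lambda>_. val_topology v"] by simp
    have "continuous_map (GL2_topology v) (val_topology v)
        ((\<lambda>x. x (i, j)) \<circ> (\<lambda>A (i, j). A $ i $ j))"
      unfolding GL2_topology_def by (rule continuous_map_pullback[OF proj])
    from continuous_map_compose[OF cont this]
    have "continuous_map T (val_topology v) (\<lambda>g. \<rho> g $ i $ j)"
      by (simp add: o_def)
    moreover have "compactin T (carrier G)"
      using compact by (simp add: compact_space_def flip: topspace_eq)
    ultimately have "compactin (val_topology v) ((\<lambda>g. \<rho> g $ i $ j) ` carrier G)"
      by (rule image_compactin[rotated])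
    then show ?thesis
    proof (rule val_bounded_of_compactin)
      fix k assume k: "\<And>x. x \<in> (\<lambda>g. \<rho> g $ i $ j) ` carrier G \<Longrightarrow> val_ge k x"
      show ?thesis
        using k by (intro exI[of _ k]) simp
    qed
  qed
  then obtain k where k: "\<And>i j. \<forall>g\<in>carrier G. val_ge (k i j) (\<rho> g $ i $ j)"
    by metis
  define K where "K = Min (range (\<lambda>(i, j). k i j))"
  have "K \<le> k i j" for i j
    unfolding K_def by (rule Min_le) (auto intro!: image_eqI[of _ _ "(i, j)"])
  with k show ?thesis
    using that[of K] by (meson val_ge_mono)
qed

text \<open>Hermite normal form: a vector of \<open>L\<close> whose first coordinate has least valuation, together
  with a vector of \<open>L\<close> on the second coordinate axis, is a basis.\<close>

lemma lattice_of_bounded_submodule: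
  assumes int: "\<And>x i. x \<in> L \<Longrightarrow> val_ge 0 (x $ i)"
    and add: "\<And>x y. x \<in> L \<Longrightarrow> y \<in> L \<Longrightarrow> x + y \<in> L"
    and scale: "\<And>q x. val_ge 0 q \<Longrightarrow> x \<in> L \<Longrightarrow> q *s x \<in> L"
    and q: "q \<noteq> 0" "q *s axis 1 1 \<in> L" "q *s axis 2 1 \<in> L"
  shows "L \<in> lattices v"
proof -
  define P where "P x \<longleftrightarrow> x \<in> L \<and> x $ 1 \<noteq> 0" for x
  define R where "R x \<longleftrightarrow> x \<in> L \<and> x $ 1 = 0 \<and> x $ 2 \<noteq> 0" for x
  have "P (q *s axis 1 1)"
    using q by (simp add: P_def axis_def)
  \<comment> \<open>Coordinates of elements of L are integral, so truncation by \<open>nat\<close>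
    loses nothing and the least number principle applies.\<close>
  then obtain a where a: "P a" "\<And>x. P x \<Longrightarrow> nat (v (a $ 1)) \<le> nat (v (x $ 1))"
    using ex_has_least_nat[of P _ "\<lambda>x. nat (v (x $ 1))"] by blast
  have "R (q *s axis 2 1)"
    using q by (simp add: R_def axis_def)
  then obtain b where b: "R b" "\<And>x. R x \<Longrightarrow> nat (v (b $ 2)) \<le> nat (v (x $ 2))"
    using ex_has_least_nat[of R _ "\<lambda>x. nat (v (x $ 2))"] by blast
  have a0: "a \<in> L" "a $ 1 \<noteq> 0" and b0: "b \<in> L" "b $ 1 = 0" "b $ 2 \<noteq> 0"
    using a(1) b(1) by (simp_all add: P_def R_def)
  have sa: "val_ge 0 (x $ 1 / a $ 1)" if x: "x \<in> L" for x
  proof (cases "x $ 1 = 0")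
    case False
    with x have "nat (v (a $ 1)) \<le> nat (v (x $ 1))"
      by (intro a(2)) (simp add: P_def)
    then have "val_ge (v (a $ 1)) (x $ 1)"
      using int[OF x, of 1] False by (auto simp: val_ge_def)
    then show ?thesis
      using a0 by (simp add: val_ge_divide_iff)
  qed simp
  have sb: "val_ge 0 (x $ 2 / b $ 2)" if x: "x \<in> L" "x $ 1 = 0" for x
  proof (cases "x $ 2 = 0")
    case False
    with x have "nat (v (b $ 2)) \<le> nat (v (x $ 2))"
      by (intro b(2)) (simp add: R_def)
    then have "val_ge (v (b $ 2)) (x $ 2)"
      using int[OF x(1), of 2] False by (auto simp: val_ge_def)
    then show ?thesis
      using b0 by (simp add: val_ge_divide_iff)
  qed simp
  have "L = lat_span a b"
  proof
    show "lat_span a b \<subseteq> L"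
      using a0 b0 by (auto simp: lat_span_def intro!: add scale)
    show "L \<subseteq> lat_span a b"
    proof
      fix x assume x: "x \<in> L"
      define s where "s = x $ 1 / a $ 1"
      define y where "y = x + (- s) *s a"
      have s: "val_ge 0 s"
        using sa[OF x] by (simp add: s_def)
      have y: "y \<in> L" "y $ 1 = 0"
      proof -
        have "val_ge 0 (- s)"
          using s by simp
        then show "y \<in> L"
          unfolding y_def using add[OF x scale[OF _ a0(1)]] by blast
        show "y $ 1 = 0"
          using a0(2) by (simp add: y_def s_def)
      qed
      have "x = s *s a + (y $ 2 / b $ 2) *s b"
        using y(2) b0 by (simp add: vec2_eq_iff) (simp add: y_def)
      then show "x \<in> lat_span a b"
        using lat_spanI[OF s sb[OF y]] by simp
    qed
  qed
  moreover have "wedge a b \<noteq> 0"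
    using a0 b0 by (simp add: wedge_def)
  ultimately show ?thesis
    by (auto simp: lattices_iff)
qed

definition stable_lattice :: "('g, 'b) monoid_scheme \<Rightarrow> ('g \<Rightarrow> 'k^2^2) \<Rightarrow> ('k^2) set \<Rightarrow> bool" where
  "stable_lattice G \<rho> L \<longleftrightarrow> (\<forall>g\<in>carrier G. (\<lambda>u. \<rho> g *v u) ` L \<subseteq> L)"

text \<open>The largest \<open>G\<close>-stable subset of the standard lattice is a lattice because the matrix
  entries of a compact group are bounded.\<close>

lemma exists_stable_lattice:
  assumes "compact_group G T" "continuous_rep G T v \<rho>"
  obtains L where "L \<in> lattices v" "stable_lattice G \<rho> L"
proof -
  interpret compact_group G T
    by fact
  have hom: "\<rho> \<in> hom G GL2"
    using assms(2) by (simp add: continuous_rep_def)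
  obtain k where k: "\<And>g i j. g \<in> carrier G \<Longrightarrow> val_ge k (\<rho> g $ i $ j)"
    using continuous_rep_bounded[OF assms] by blast
  define L where "L = {u. \<forall>g\<in>carrier G. \<forall>i. val_ge 0 ((\<rho> g *v u) $ i)}"
  note one = GL2_hom_one[OF hom]
  \<comment> \<open>A scalar of valuation -k cancels the bound k on the matrix entries, so the
    scaled standard basis vectors stay integral under all of G.\<close>
  have "- k \<in> v ` (UNIV - {0})"
    by (simp add: val_surj)
  then obtain q where q: "q \<noteq> 0" "v q = - k"
    unfolding image_iff by fastforce
  have "L \<in> lattices v"
  proof (rule lattice_of_bounded_submodule)
    show "val_ge 0 (x $ i)" if "x \<in> L" for x i
    proof -
      have "val_ge 0 ((\<rho> \<one>\<^bsub>G\<^esub> *v x) $ i)"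
        using that one_closed unfolding L_def by blast
      then show ?thesis
        by (simp add: one)
    qed
    show "x + y \<in> L" if "x \<in> L" "y \<in> L" for x y
      using that by (auto simp: L_def matrix_vector_right_distrib intro: val_ge_add)
    show "c *s x \<in> L" if "val_ge 0 c" "x \<in> L" for c x
      using that by (auto simp: L_def vector_scalar_commute intro: val_ge_mult_left)
    show "q *s axis 1 1 \<in> L" "q *s axis 2 1 \<in> L"
      using k q by (simp_all add: L_def matrix_vector_mult_2_nth axis_def val_ge_mult_iff mult.commute[of _ q])
  qed (fact q(1))
  moreover have "stable_lattice G \<rho> L"
    unfolding stable_lattice_def
  proof (intro ballI subsetI)
    fix h u assume h: "h \<in> carrier G" and "u \<in> (\<lambda>u. \<rho> h *v u) ` L"
    then obtain w where w: "w \<in> L" "u = \<rho> h *v w"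
      by blast
    have "\<rho> g *v u = \<rho> (g \<otimes>\<^bsub>G\<^esub> h) *v w" if "g \<in> carrier G" for g
      using hom_mult[OF hom that h] w by (simp add: GL2_def matrix_vector_mul_assoc)
    with w(1) h show "u \<in> L"
      by (auto simp: L_def)
  qed
  ultimately show ?thesis
    using that by blast
qed

lemma stable_lattice_scale:
  assumes "stable_lattice G \<rho> L"
  shows "stable_lattice G \<rho> ((\<lambda>u. q *s u) ` L)"
  unfolding stable_lattice_def
proof (intro ballI)
  fix g assume "g \<in> carrier G"
  then have "(\<lambda>u. \<rho> g *v u) ` L \<subseteq> L"
    using assms by (simp add: stable_lattice_def)
  then show "(\<lambda>u. \<rho> g *v u) ` (\<lambda>u. q *s u) ` L \<subseteq> (\<lambda>u. q *s u) ` L"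
    by (auto simp: vector_scalar_commute intro!: imageI)
qed

lemma stable_vertexI:
  assumes "L \<in> lattices v" "stable_lattice G \<rho> L"
  shows "homothety v `` {L} \<in> stable_vertices G v \<rho>"
proof -
  have "stable_lattice G \<rho> M" if "M \<in> homothety v `` {L}" for M
  proof -
    have "\<exists>q. q \<noteq> 0 \<and> M = (\<lambda>u. q *s u) ` L"
      using that unfolding homothety_class_iff[OF assms(1)] .
    then show ?thesis
      using stable_lattice_scale[OF assms(2)] by (elim exE conjE) simp
  qed
  then show ?thesis
    unfolding stable_vertices_def stable_lattice_def[symmetric]
    by (intro CollectI conjI ballI vertexI[OF assms(1)])
qed

lemma stable_vertexD: "x \<in> stable_vertices G v \<rho> \<Longrightarrow> L \<in> x \<Longrightarrow> stable_lattice G \<rho> L"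
  by (simp add: stable_vertices_def stable_lattice_def)

section \<open>Stability read off from matrix entries\<close>

lemma wedge_columns:
  fixes P :: "'k^2^2"
  shows "wedge (column 1 P) (column 2 P) = P $ 1 $ 1 * P $ 2 $ 2 - P $ 1 $ 2 * P $ 2 $ 1"
  by (simp add: wedge_def column_def mult.commute)

text \<open>Column j of B holds the coordinates of A times the j-th basis vector.\<close>

lemma lat_span_columns_subset_iff:
  fixes A B P :: "'k^2^2"
  assumes "invertible P" "A ** P = P ** B"
  shows "(\<lambda>u. A *v u) ` lat_span (column 1 P) (column 2 P) \<subseteq> lat_span (column 1 P) (column 2 P)
    \<longleftrightarrow> (\<forall>i j. val_ge 0 (B $ i $ j))"
proof -
  let ?a = "column 1 P" and ?b = "column 2 P"
  have w: "wedge ?a ?b \<noteq> 0"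
    using assms(1) by (simp add: wedge_columns invertible_2_iff)
  have col: "A *v column j P = B $ 1 $ j *s ?a + B $ 2 $ j *s ?b" for j
  proof -
    have "(A ** P) $ i $ j = (P ** B) $ i $ j" for i
      using assms(2) by simp
    then show ?thesis
      by (simp add: vec_eq_iff matrix_vector_mult_2_nth column_def mult.commute)
  qed
  have lin: "A *v (s *s ?a + t *s ?b) = s *s (A *v ?a) + t *s (A *v ?b)" for s t
    by (simp add: matrix_vector_right_distrib vector_scalar_commute)
  have image: "(\<lambda>u. A *v u) ` lat_span ?a ?b = lat_span (A *v ?a) (A *v ?b)"
    unfolding lat_span_image image_image by (simp add: case_prod_unfold lin)
  show ?thesis
    unfolding image lat_span_subset_iff col lat_span_comb_iff[OF w] forall_2 by blast
qed

lemma obtain_columns: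
  fixes a b :: "'k^2"
  assumes "wedge a b \<noteq> 0"
  obtains P :: "'k^2^2" where "invertible P" "column 1 P = a" "column 2 P = b"
proof
  show "invertible (mat2 (a $ 1) (b $ 1) (a $ 2) (b $ 2))"
    using assms by (simp add: invertible_2_iff wedge_def algebra_simps)
qed (simp_all add: column_def vec2_eq_iff)

end


section \<open>Characters and stable lattices\<close>

text \<open>The values are automatically units: f (inv g) inverts f g.\<close>

lemma (in group) hom_units_ofI:
  assumes "monoid R" and closed: "\<And>g. g \<in> carrier G \<Longrightarrow> f g \<in> carrier R"
    and mult: "\<And>g h. g \<in> carrier G \<Longrightarrow> h \<in> carrier G \<Longrightarrow> f (g \<otimes> h) = f g \<otimes>\<^bsub>R\<^esub> f h"
    and one: "f \<one> = \<one>\<^bsub>R\<^esub>"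
  shows "f \<in> hom G (units_of R)"
proof (rule homI)
  fix g assume g: "g \<in> carrier G"
  have "f (inv g) \<otimes>\<^bsub>R\<^esub> f g = \<one>\<^bsub>R\<^esub>" "f g \<otimes>\<^bsub>R\<^esub> f (inv g) = \<one>\<^bsub>R\<^esub>"
    using g by (simp_all add: one flip: mult)
  with g closed[of g] closed[of "inv g"] show "f g \<in> carrier (units_of R)"
    unfolding units_of_carrier Units_def by auto
qed (simp add: mult units_of_mult)

lemma (in group) conj_GL2_hom:
  fixes \<rho> :: "'a \<Rightarrow> 'k::field^2^2"
  assumes hom: "\<rho> \<in> hom G GL2" and P: "invertible P"
  shows "\<exists>Y. (\<forall>g. \<rho> g ** P = P ** Y g \<and> trace (Y g) = trace (\<rho> g)) \<and>
    (\<forall>g\<in>carrier G. \<forall>h\<in>carrier G. Y (g \<otimes> h) = Y g ** Y h) \<and> Y \<one> = mat 1"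
proof -
  obtain Q where Q: "P ** Q = mat 1" "Q ** P = mat 1"
    using P unfolding invertible_def by blast
  define Y where "Y g = Q ** \<rho> g ** P" for g
  have 1: "\<rho> g ** P = P ** Y g" for g
    by (simp add: Y_def matrix_mul_assoc Q)
  have 2: "trace (Y g) = trace (\<rho> g)" for g
  proof -
    have "trace (Y g) = trace ((\<rho> g ** P) ** Q)"
      unfolding Y_def matrix_mul_assoc[symmetric] by (subst trace_mul_sym) (simp add: matrix_mul_assoc)
    also have "\<dots> = trace (\<rho> g)"
      by (simp add: matrix_mul_assoc[symmetric] Q)
    finally show ?thesis .
  qed
  have 3: "Y (g \<otimes> h) = Y g ** Y h" if "g \<in> carrier G" "h \<in> carrier G" for g h
  proof -
    have "\<rho> (g \<otimes> h) = \<rho> g ** (P ** Q) ** \<rho> h"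
      using hom_mult[OF hom that] by (simp add: GL2_def Q)
    then show ?thesis
      by (simp add: Y_def matrix_mul_assoc)
  qed
  have 4: "Y \<one> = mat 1"
    by (simp add: Y_def Q GL2_hom_one[OF hom])
  from 1 2 3 4 show ?thesis
    by (intro exI[of _ Y]) simp
qed

context discretely_valued_field
begin

lemma stable_lattice_columns_iff:
  fixes P :: "'k^2^2"
  assumes "invertible P" "\<And>g. g \<in> carrier G \<Longrightarrow> \<rho> g ** P = P ** Y g"
  shows "stable_lattice G \<rho> (lat_span (column 1 P) (column 2 P)) \<longleftrightarrow>
    (\<forall>g\<in>carrier G. \<forall>i j. val_ge 0 (Y g $ i $ j))"
  unfolding stable_lattice_def using lat_span_columns_subset_iff[OF assms(1) assms(2)] by simp

text \<open>Conjugation by diag(1, q) multiplies the upper right entry by q and divides the lower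
  left one by q; only the latter can spoil integrality.\<close>

lemma stable_lattice_columns_scaled_iff:
  fixes P :: "'k^2^2"
  assumes P: "invertible P" and Y: "\<And>g. g \<in> carrier G \<Longrightarrow> \<rho> g ** P = P ** Y g" and q: "q \<noteq> 0"
    and int: "\<And>g i j. g \<in> carrier G \<Longrightarrow> val_ge 0 (Y g $ i $ j)" and q_int: "val_ge 0 q"
  shows "stable_lattice G \<rho> (lat_span (column 1 P) (q *s column 2 P)) \<longleftrightarrow>
    (\<forall>g\<in>carrier G. val_ge (v q) (Y g $ 2 $ 1))"
proof -
  define D where "D = mat2 1 0 0 q"
  define Z where "Z g = mat2 (Y g $ 1 $ 1) (Y g $ 1 $ 2 * q) (Y g $ 2 $ 1 / q) (Y g $ 2 $ 2)" for g
  have D: "invertible D"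
    using q by (simp add: D_def invertible_2_iff)
  have YD: "Y g ** D = D ** Z g" for g
    using q by (simp add: D_def Z_def mat2_eq_iff)
  have "\<rho> g ** (P ** D) = (P ** D) ** Z g" if "g \<in> carrier G" for g
    using Y[OF that] YD[of g] by (metis matrix_mul_assoc)
  note iff = stable_lattice_columns_iff[OF invertible_mult[OF P D] this]
  have "column 1 (P ** D) = column 1 P" "column 2 (P ** D) = q *s column 2 P"
    by (simp_all add: column_def D_def vec_eq_iff mult.commute)
  with iff have "stable_lattice G \<rho> (lat_span (column 1 P) (q *s column 2 P)) \<longleftrightarrow>
      (\<forall>g\<in>carrier G. \<forall>i j. val_ge 0 (Z g $ i $ j))"
    by simp
  also have "\<dots> \<longleftrightarrow> (\<forall>g\<in>carrier G. val_ge (v q) (Y g $ 2 $ 1))"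
    using int q by (simp add: forall_2 Z_def val_ge_mult_right[OF _ q_int] val_ge_divide_iff)
  finally show ?thesis .
qed

end

context uniformised_field
begin

text \<open>In a basis adapted to both lattices the representation is integral and upper triangular
  modulo p^n, so its diagonal entries are multiplicative modulo p^n.\<close>

lemma characters_of_stable_vertices:
  assumes G: "group G" and hom: "\<rho> \<in> hom G GL2"
    and xy: "x \<in> stable_vertices G v \<rho>" "y \<in> stable_vertices G v \<rho>"
    and n: "vertex_dist v p x y = n"
  shows "\<exists>\<chi>1 \<chi>2. \<chi>1 \<in> hom G (units_of (residue_ring_pow v p n)) \<and>
    \<chi>2 \<in> hom G (units_of (residue_ring_pow v p n)) \<and>
    (\<forall>g\<in>carrier G. residue_class v p n (trace (\<rho> g)) =
      \<chi>1 g \<oplus>\<^bsub>residue_ring_pow v p n\<^esub> \<chi>2 g)"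
proof -
  interpret group G
    by (rule G)
  let ?Q = "residue_ring_pow v p n" and ?c = "residue_class v p n"
  interpret Q: ring ?Q
    by (rule ring_residue_ring_pow[OF uniformiser])
  have xy_vert: "x \<in> vertices v" "y \<in> vertices v"
    using xy by (simp_all add: stable_vertices_def)
  obtain L M a b where L: "L \<in> x" "M \<in> y" "lattice_basis v a b L"
    "lattice_basis v a (p ^ n *s b) M"
    by (rule vertex_dist_bases[OF uniformiser xy_vert, unfolded n])
  have w: "wedge a b \<noteq> 0" "L = lat_span a b" "M = lat_span a (p ^ n *s b)"
    using L(3,4) by (simp_all add: lattice_basis_iff)
  obtain P :: "'a^2^2" where P: "invertible P" "column 1 P = a" "column 2 P = b"
    by (rule obtain_columns[OF w(1)])
  obtain Y where Y: "\<And>g. \<rho> g ** P = P ** Y g" and tr: "\<And>g. trace (Y g) = trace (\<rho> g)"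
    and mult: "\<And>g h. g \<in> carrier G \<Longrightarrow> h \<in> carrier G \<Longrightarrow> Y (g \<otimes>\<^bsub>G\<^esub> h) = Y g ** Y h"
    and one: "Y \<one>\<^bsub>G\<^esub> = mat 1"
    using conj_GL2_hom[OF hom P(1)] by blast
  have int: "val_ge 0 (Y g $ i $ j)" if "g \<in> carrier G" for g i j
    using stable_vertexD[OF xy(1) L(1)] stable_lattice_columns_iff[of P G \<rho> Y] P Y w that by simp
  have pn: "p ^ n \<noteq> 0" "val_ge 0 (p ^ n)"
    by (simp_all add: p_nz val_ge_def val_p_power)
  have low: "val_ge (int n) (Y g $ 2 $ 1)" if "g \<in> carrier G" for g
    using stable_vertexD[OF xy(2) L(2)] stable_lattice_columns_scaled_iff[of P G \<rho> Y "p ^ n"]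
      P Y w pn int that by (simp add: val_p_power)
  have char: "(\<lambda>g. ?c (Y g $ i $ i)) \<in> hom G (units_of ?Q)" for i
  proof (rule hom_units_ofI)
    show "monoid ?Q"
      by (rule Q.monoid_axioms)
    show "?c (Y g $ i $ i) \<in> carrier ?Q" if "g \<in> carrier G" for g
      using int[OF that] by (rule residue_class_closed[OF uniformiser])
    show "?c (Y \<one>\<^bsub>G\<^esub> $ i $ i) = \<one>\<^bsub>?Q\<^esub>"
      by (simp add: one mat_def residue_class_one[OF uniformiser])
    fix g h assume gh: "g \<in> carrier G" "h \<in> carrier G"
    have ints: "val_ge 0 (Y (g \<otimes>\<^bsub>G\<^esub> h) $ i $ i)" "val_ge 0 (Y g $ i $ i * Y h $ i $ i)"
      using int gh by (simp_all add: val_ge_mult_left)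
    have "val_ge (int n) (Y g $ 1 $ 2 * Y h $ 2 $ 1)" "val_ge (int n) (Y g $ 2 $ 1 * Y h $ 1 $ 2)"
      using val_ge_mult_left[OF int low] val_ge_mult_right[OF low int] gh by blast+
    then have "val_ge (int n) (Y (g \<otimes>\<^bsub>G\<^esub> h) $ i $ i - Y g $ i $ i * Y h $ i $ i)"
      using exhaust_2[of i] by (auto simp: mult[OF gh])
    then have "?c (Y (g \<otimes>\<^bsub>G\<^esub> h) $ i $ i) = ?c (Y g $ i $ i * Y h $ i $ i)"
      by (simp add: residue_class_eq_iff[OF uniformiser ints])
    then show "?c (Y (g \<otimes>\<^bsub>G\<^esub> h) $ i $ i) = ?c (Y g $ i $ i) \<otimes>\<^bsub>?Q\<^esub> ?c (Y h $ i $ i)"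
      using residue_class_mult[OF uniformiser int int] gh by simp
  qed
  have "?c (trace (\<rho> g)) = ?c (Y g $ 1 $ 1) \<oplus>\<^bsub>?Q\<^esub> ?c (Y g $ 2 $ 2)" if "g \<in> carrier G" for g
    unfolding tr[of g, symmetric] unfolding trace_2
    using residue_class_add[OF uniformiser int[OF that] int[OF that]] by simp
  with char show ?thesis
    by (intro exI[of _ "\<lambda>g. ?c (Y g $ 1 $ 1)"] exI[of _ "\<lambda>g. ?c (Y g $ 2 $ 2)"]) simp
qed

text \<open>L supplies a basis in which the representation is integral; the base change given by the
  trace form then produces the two lattices at distance n.\<close>

lemma stable_vertices_of_characters:
  assumes G: "group G" and hom: "\<rho> \<in> hom G GL2"
    and L: "L \<in> lattices v" "stable_lattice G \<rho> L"
    and chi: "\<chi>1 \<in> hom G (units_of (residue_ring_pow v p n))"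
      "\<chi>2 \<in> hom G (units_of (residue_ring_pow v p n))"
    and trace_chi: "\<And>g. g \<in> carrier G \<Longrightarrow>
      residue_class v p n (trace (\<rho> g)) = \<chi>1 g \<oplus>\<^bsub>residue_ring_pow v p n\<^esub> \<chi>2 g"
  shows "\<exists>x\<in>stable_vertices G v \<rho>. \<exists>y\<in>stable_vertices G v \<rho>. vertex_dist v p x y = n"
proof -
  interpret group G
    by (rule G)
  let ?Q = "residue_ring_pow v p n" and ?c = "residue_class v p n"
  interpret Q: ring ?Q
    by (rule ring_residue_ring_pow[OF uniformiser])
  \<comment> \<open>Representatives in O_K are chosen arbitrarily, so a lift is multiplicative only
    modulo p^n, which suffices for the trace congruence.\<close>
  have lift: "\<exists>f. (\<forall>g\<in>carrier G. val_ge 0 (f g) \<and> \<psi> g = ?c (f g)) \<and>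
      (\<forall>g\<in>carrier G. \<forall>h\<in>carrier G. val_ge (int n) (f (g \<otimes>\<^bsub>G\<^esub> h) - f g * f h))"
    if hom_chi: "\<psi> \<in> hom G (units_of ?Q)" for \<psi>
  proof -
    have "\<exists>x. val_ge 0 x \<and> \<psi> g = ?c x" if "g \<in> carrier G" for g
    proof -
      have "\<psi> g \<in> carrier ?Q"
        using hom_in_carrier[OF hom_chi that] by (simp add: units_of_carrier Q.Units_closed)
      then show ?thesis
        by (rule residue_class_surj) blast
    qed
    then have "\<forall>g\<in>carrier G. \<exists>x. val_ge 0 x \<and> \<psi> g = ?c x"
      by blast
    from bchoice[OF this] obtain f where
      f: "\<And>g. g \<in> carrier G \<Longrightarrow> val_ge 0 (f g)" "\<And>g. g \<in> carrier G \<Longrightarrow> \<psi> g = ?c (f g)"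
      by blast
    have "val_ge (int n) (f (g \<otimes>\<^bsub>G\<^esub> h) - f g * f h)"
      if gh: "g \<in> carrier G" "h \<in> carrier G" for g h
    proof -
      have ints: "val_ge 0 (f (g \<otimes>\<^bsub>G\<^esub> h))" "val_ge 0 (f g * f h)"
        using f(1) gh by (simp_all add: val_ge_mult_left)
      have "?c (f (g \<otimes>\<^bsub>G\<^esub> h)) = ?c (f g * f h)"
        using hom_mult[OF hom_chi gh] f gh residue_class_mult[OF uniformiser f(1) f(1)]
        by (simp add: units_of_mult)
      then show ?thesis
        by (simp add: residue_class_eq_iff[OF uniformiser ints])
    qed
    with f show ?thesis
      by blast
  qed
  from lift[OF chi(1)] obtain c1 where
    c1: "\<And>g. g \<in> carrier G \<Longrightarrow> val_ge 0 (c1 g)" "\<And>g. g \<in> carrier G \<Longrightarrow> \<chi>1 g = ?c (c1 g)"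
    and c1_mult: "\<And>g h. g \<in> carrier G \<Longrightarrow> h \<in> carrier G \<Longrightarrow>
      val_ge (int n) (c1 (g \<otimes>\<^bsub>G\<^esub> h) - c1 g * c1 h)"
    by blast
  from lift[OF chi(2)] obtain c2 where
    c2: "\<And>g. g \<in> carrier G \<Longrightarrow> val_ge 0 (c2 g)" "\<And>g. g \<in> carrier G \<Longrightarrow> \<chi>2 g = ?c (c2 g)"
    and c2_mult: "\<And>g h. g \<in> carrier G \<Longrightarrow> h \<in> carrier G \<Longrightarrow>
      val_ge (int n) (c2 (g \<otimes>\<^bsub>G\<^esub> h) - c2 g * c2 h)"
    by blast
  obtain a0 b0 where ab0: "L = lat_span a0 b0" "wedge a0 b0 \<noteq> 0"
    using L(1) by (auto simp: lattices_iff)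
  obtain P :: "'a^2^2" where P: "invertible P" "column 1 P = a0" "column 2 P = b0"
    by (rule obtain_columns[OF ab0(2)])
  obtain Y where Y: "\<And>g. \<rho> g ** P = P ** Y g" and tr: "\<And>g. trace (Y g) = trace (\<rho> g)"
    and mult: "\<And>g h. g \<in> carrier G \<Longrightarrow> h \<in> carrier G \<Longrightarrow> Y (g \<otimes>\<^bsub>G\<^esub> h) = Y g ** Y h"
    using conj_GL2_hom[OF hom P(1)] by blast
  have int: "val_ge 0 (Y g $ i $ j)" if "g \<in> carrier G" for g i j
    using L(2) stable_lattice_columns_iff[of P G \<rho> Y] P Y ab0 that by simp
  define t where "t g = Y g $ 1 $ 1 + Y g $ 2 $ 2" for g
  have t_int: "val_ge 0 (t g)" if "g \<in> carrier G" for g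
    unfolding t_def using int[OF that] by (intro val_ge_add)
  have t_chi: "val_ge (int n) (t g - (c1 g + c2 g))" if g: "g \<in> carrier G" for g
  proof -
    have "?c (t g) = ?c (c1 g + c2 g)"
      using trace_chi[OF g] c1 c2 g residue_class_add[OF uniformiser c1(1) c2(1)]
      by (simp add: t_def trace_2[symmetric] tr)
    then show ?thesis
      using residue_class_eq_iff[OF uniformiser t_int[OF g] val_ge_add[OF c1(1)[OF g] c2(1)[OF g]]]
      by simp
  qed

  define a where "a g = (Y g $ 1 $ 1 - Y g $ 2 $ 2) / 2" for g
  define b where "b g = Y g $ 1 $ 2" for g
  define c where "c g = Y g $ 2 $ 1" for g
  define d where "d g = (c1 g - c2 g) / 2" for g
  have "reducible_mod (carrier G) n a b c"
  proof (rule reducible_mod_of_tr_form[where d = d])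
    show "integral_families (carrier G) a b c"
      using int by (simp add: integral_families_def a_def b_def c_def val_ge_half_iff val_ge_diff)
    show "val_ge 0 (d g)" if "g \<in> carrier G" for g
      using c1(1)[OF that] c2(1)[OF that] by (simp add: d_def val_ge_half_iff val_ge_diff)
    show "val_ge (int n) (tr_form a b c g h - 2 * d g * d h)"
      if gh: "g \<in> carrier G" "h \<in> carrier G" for g h
    proof -
      define s where "s g = c1 g + c2 g" for g
      have "val_ge (int n) ((t (g \<otimes>\<^bsub>G\<^esub> h) - s (g \<otimes>\<^bsub>G\<^esub> h))
          + ((c1 (g \<otimes>\<^bsub>G\<^esub> h) - c1 g * c1 h) + (c2 (g \<otimes>\<^bsub>G\<^esub> h) - c2 g * c2 h)))"
        unfolding s_def by (intro val_ge_add t_chi c1_mult c2_mult m_closed gh)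
      then have 1: "val_ge (int n) (t (g \<otimes>\<^bsub>G\<^esub> h) - (c1 g * c1 h + c2 g * c2 h))"
        by (simp add: s_def algebra_simps)
      have "val_ge (int n) ((t g - s g) * t h + s g * (t h - s h))"
        unfolding s_def using gh
        by (intro val_ge_add val_ge_mult_left val_ge_mult_right t_chi t_int c1(1) c2(1))
      then have 2: "val_ge (int n) ((t g * t h - s g * s h) / 2)"
        by (simp add: val_ge_half_iff algebra_simps)
      have t_mult: "t (g \<otimes>\<^bsub>G\<^esub> h) = Y g $ 1 $ 1 * Y h $ 1 $ 1 + Y g $ 1 $ 2 * Y h $ 2 $ 1
          + Y g $ 2 $ 1 * Y h $ 1 $ 2 + Y g $ 2 $ 2 * Y h $ 2 $ 2"
        by (simp add: t_def mult[OF gh])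
      have double: "2 * a x = Y x $ 1 $ 1 - Y x $ 2 $ 2" "2 * d x = c1 x - c2 x" for x
        using two_nz by (simp_all add: a_def d_def)
      have half: "2 * (z / 2) = z" for z :: 'a
        using two_nz by simp
      \<comment> \<open>Doubling clears denominators, as a and d are halves; the result exhibits the
        defect of the form as the difference of the two congruences 1 and 2.\<close>
      have "2 * (tr_form a b c g h - 2 * d g * d h) =
          (2 * a g) * (2 * a h) + 2 * (b g * c h + b h * c g) - (2 * d g) * (2 * d h)"
        by (simp add: tr_form_def algebra_simps)
      also have "\<dots> = 2 * (t (g \<otimes>\<^bsub>G\<^esub> h) - (c1 g * c1 h + c2 g * c2 h))
          - (t g * t h - s g * s h)"
        unfolding double t_mult
        by (simp add: b_def c_def t_def[of g] t_def[of h] s_def algebra_simps)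
      also have "\<dots> = 2 * ((t (g \<otimes>\<^bsub>G\<^esub> h) - (c1 g * c1 h + c2 g * c2 h))
          - (t g * t h - s g * s h) / 2)"
        by (simp only: right_diff_distrib half)
      finally have "2 * (tr_form a b c g h - 2 * d g * d h) = 2 * ((t (g \<otimes>\<^bsub>G\<^esub> h)
          - (c1 g * c1 h + c2 g * c2 h)) - (t g * t h - s g * s h) / 2)" .
      then have "tr_form a b c g h - 2 * d g * d h = (t (g \<otimes>\<^bsub>G\<^esub> h)
          - (c1 g * c1 h + c2 g * c2 h)) - (t g * t h - s g * s h) / 2"
        using two_nz by (simp only: mult_cancel_left) simp
      with val_ge_diff[OF 1 2] show ?thesis
        by simp
    qed
  qed
  then obtain a' b' c' where
    conj: "conj_families (carrier G) (\<lambda>g. sl2 (a g) (b g) (c g)) (\<lambda>g. sl2 (a' g) (b' g) (c' g))"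
    and a': "\<And>g. g \<in> carrier G \<Longrightarrow> val_ge 0 (a' g)"
    and b': "\<And>g. g \<in> carrier G \<Longrightarrow> val_ge 0 (b' g)"
    and c': "\<And>g. g \<in> carrier G \<Longrightarrow> val_ge (int n) (c' g)"
    unfolding reducible_mod_def by blast
  from conj obtain R where R: "invertible R"
    and conj_R: "\<And>g. g \<in> carrier G \<Longrightarrow> sl2 (a g) (b g) (c g) ** R = R ** sl2 (a' g) (b' g) (c' g)"
    unfolding conj_families_def by blast
  \<comment> \<open>Scalars commute with R, so adding t g / 2 back to the traceless part turns its
    conjugation into one of Y g.\<close>
  define Z where "Z g = mat2 (t g / 2 + a' g) (b' g) (c' g) (t g / 2 - a' g)" for g
  have YR: "Y g ** R = R ** Z g" if "g \<in> carrier G" for g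
  proof -
    have Y11: "Y g $ 1 $ 1 = t g / 2 + a g" and Y22: "Y g $ 2 $ 2 = t g / 2 - a g"
      unfolding t_def a_def add_divide_distrib[symmetric] diff_divide_distrib[symmetric]
      using two_nz by (simp_all flip: mult_2)
    show ?thesis
      using conj_R[OF that]
      by (simp add: mat2_eq_iff Z_def Y11 Y22 b_def[symmetric] c_def[symmetric] algebra_simps)
  qed
  have PR: "invertible (P ** R)"
    by (rule invertible_mult[OF P(1) R])
  have conj_PR: "\<rho> g ** (P ** R) = (P ** R) ** Z g" if "g \<in> carrier G" for g
    using Y[of g] YR[OF that] by (metis matrix_mul_assoc)
  have Z_int: "val_ge 0 (Z g $ i $ j)" if "g \<in> carrier G" for g i j
  proof -
    have "val_ge 0 (t g / 2)" "val_ge 0 (c' g)"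
      using t_int[OF that] val_ge_mono[OF c'[OF that]] by (simp_all add: val_ge_half_iff)
    then have "\<forall>i j. val_ge 0 (Z g $ i $ j)"
      using a'[OF that] b'[OF that] by (simp add: forall_2 Z_def val_ge_add val_ge_diff)
    then show ?thesis
      by blast
  qed
  define u where "u = column 1 (P ** R)"
  define w where "w = column 2 (P ** R)"
  have uw: "wedge u w \<noteq> 0"
    using PR by (simp add: u_def w_def wedge_columns invertible_2_iff del: matrix_mult_2_nth)
  have pn: "p ^ n \<noteq> 0" "val_ge 0 (p ^ n)"
    by (simp_all add: p_nz val_ge_def val_p_power)
  have uw': "wedge u (p ^ n *s w) \<noteq> 0"
    using uw pn(1) by (simp add: wedge_def algebra_simps)
  have stable1: "stable_lattice G \<rho> (lat_span u w)"
    unfolding u_def w_def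
    using stable_lattice_columns_iff[of "P ** R" G \<rho> Z] PR conj_PR Z_int by blast
  have stable2: "stable_lattice G \<rho> (lat_span u (p ^ n *s w))"
    unfolding u_def w_def
    using stable_lattice_columns_scaled_iff[of "P ** R" G \<rho> Z "p ^ n"] PR conj_PR pn Z_int c'
    by (simp add: Z_def val_p_power)
  let ?x = "homothety v `` {lat_span u w}" and ?y = "homothety v `` {lat_span u (p ^ n *s w)}"
  note lat = lattices_lat_span[OF uw] lattices_lat_span[OF uw']
  have "vertex_dist v p ?x ?y = n"
  proof (rule vertex_dist_eqI[OF uniformiser])
    show "?x \<in> vertices v" "?y \<in> vertices v"
      using lat by (auto intro: vertexI)
    show "lat_span u w \<in> ?x" "lat_span u (p ^ n *s w) \<in> ?y"
      using equiv_class_self[OF equiv_homothety] lat by blast+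
    show "lattice_basis v u w (lat_span u w)"
      "lattice_basis v u (p ^ n *s w) (lat_span u (p ^ n *s w))"
      using uw uw' by (simp_all add: lattice_basis_iff)
  qed
  moreover have "?x \<in> stable_vertices G v \<rho>" "?y \<in> stable_vertices G v \<rho>"
    using stable_vertexI lat stable1 stable2 by blast+
  ultimately show ?thesis
    by blast
qed

end

theorem theorem1p4:
  fixes v :: "'k::field \<Rightarrow> int" and p :: 'k
    and G :: "('g, 'b) monoid_scheme" and T :: "'g topology"
    and \<rho> :: "'g \<Rightarrow> 'k^2^2" and n :: nat
  assumes "complete_discretely_valued_field v"
    and "uniformiser v p"
    and "ring_characteristic (residue_ring_pow v p 1) \<noteq> 2"
    and "compact_group G T"
    and "continuous_rep G T v \<rho>"
    and "n > 0"
  shows "(\<exists>x\<in>stable_vertices G v \<rho>. \<exists>y\<in>stable_vertices G v \<rho>. vertex_dist v p x y = n) \<longleftrightarrow>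
    (\<exists>\<chi>\<^sub>1 \<chi>\<^sub>2. \<chi>\<^sub>1 \<in> hom G (units_of (residue_ring_pow v p n)) \<and>
       \<chi>\<^sub>2 \<in> hom G (units_of (residue_ring_pow v p n)) \<and>
       (\<forall>g\<in>carrier G. residue_class v p n (trace (\<rho> g)) =
          \<chi>\<^sub>1 g \<oplus>\<^bsub>residue_ring_pow v p n\<^esub> \<chi>\<^sub>2 g))"
proof -
  interpret discretely_valued_field v
    using assms(1) by (simp add: complete_discretely_valued_field_def)
  interpret uniformised_field v p
  proof
    show "p \<noteq> 0" "v p = 1"
      using assms(2) by (simp_all add: uniformiser_def)
  qed (rule val_two_of_residue_characteristic[OF assms(2,3)])+
  have G: "group G" and hom: "\<rho> \<in> hom G GL2"
    using assms(4,5) by (simp_all add: compact_group_def continuous_rep_def)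
  obtain L where L: "L \<in> lattices v" "stable_lattice G \<rho> L"
    using exists_stable_lattice[OF assms(4,5)] by blast
  show ?thesis
  proof
    assume "\<exists>x\<in>stable_vertices G v \<rho>. \<exists>y\<in>stable_vertices G v \<rho>. vertex_dist v p x y = n"
    then obtain x y where xy: "x \<in> stable_vertices G v \<rho>" "y \<in> stable_vertices G v \<rho>"
      "vertex_dist v p x y = n"
      by blast
    show "\<exists>\<chi>\<^sub>1 \<chi>\<^sub>2. \<chi>\<^sub>1 \<in> hom G (units_of (residue_ring_pow v p n)) \<and>
        \<chi>\<^sub>2 \<in> hom G (units_of (residue_ring_pow v p n)) \<and>
        (\<forall>g\<in>carrier G. residue_class v p n (trace (\<rho> g)) =
          \<chi>\<^sub>1 g \<oplus>\<^bsub>residue_ring_pow v p n\<^esub> \<chi>\<^sub>2 g)"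
      by (rule characters_of_stable_vertices[OF G hom xy])
  next
    assume "\<exists>\<chi>\<^sub>1 \<chi>\<^sub>2. \<chi>\<^sub>1 \<in> hom G (units_of (residue_ring_pow v p n)) \<and>
        \<chi>\<^sub>2 \<in> hom G (units_of (residue_ring_pow v p n)) \<and>
        (\<forall>g\<in>carrier G. residue_class v p n (trace (\<rho> g)) =
          \<chi>\<^sub>1 g \<oplus>\<^bsub>residue_ring_pow v p n\<^esub> \<chi>\<^sub>2 g)"
    then obtain \<chi>1 \<chi>2 where chi: "\<chi>1 \<in> hom G (units_of (residue_ring_pow v p n))"
      "\<chi>2 \<in> hom G (units_of (residue_ring_pow v p n))"
      "\<forall>g\<in>carrier G. residue_class v p n (trace (\<rho> g)) =
        \<chi>1 g \<oplus>\<^bsub>residue_ring_pow v p n\<^esub> \<chi>2 g"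
      by (elim exE conjE)
    show "\<exists>x\<in>stable_vertices G v \<rho>. \<exists>y\<in>stable_vertices G v \<rho>. vertex_dist v p x y = n"
      by (rule stable_vertices_of_characters[OF G hom L chi(1,2)]) (rule bspec[OF chi(3)])
  qed
qed

end
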